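(* Let $p$ be a prime and let $G$ be a non-abelian finite $p$-group of order $p^n$ with $d(G) = d$, $|\gamma_2(G)| = p^k$ and $G^{ab} \cong C_{p^{\alpha_1}} \times C_{p^{\alpha_2}} \times \cdots \times C_{p^{\alpha_d}}$, where $\alpha_1 \geq \alpha_2 \geq \cdots \geq \alpha_d$. Then \[|M(G)| \leq p^{\frac{1}{2}(d-1)(n+k-2-(\alpha_1-\alpha_d))+1}.\] In particular, if $G^{ab}$ is not homocyclic, then \[|M(G)| \leq p^{\frac{1}{2}(d-1)(n+k-3)+1}.\]
   Context: $\gamma_2(G)=[G,G]$ is the commutator subgroup of $G$; $G^{ab}=G/\gamma_2(G)$; $C_m$ is the cyclic group of order $m$; $d(G)$ is the minimal number of generators of $G$ (so all $\alpha_i\ge 1$); an abelian $p$-group is homocyclic if it is a direct product of cyclic groups all of the same order, i.e. here $\alpha_1=\alpha_2=\cdots=\alpha_d$; $M(G)$ is the Schur multiplier of $G$, i.e. $M(G)=H^2(G,\mathbb{C}^{\times})$ with trivial action (for finite $G$, isomorphic to $H_2(G,\mathbb{Z})$). The exponents of $p$ are rational numbers, so the inequalities are between real numbers. *)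

theory Defs
  imports Complex_Main "HOL-Algebra.Algebra"
begin

definition complex_units :: "complex monoid" where
  "complex_units = \<lparr>carrier = - {0}, monoid.mult = (*), one = 1\<rparr>"

definition cochain_group2 :: "('a, 'b) monoid_scheme \<Rightarrow> ('a \<times> 'a \<Rightarrow> complex) monoid" where
  "cochain_group2 G = product_group (carrier G \<times> carrier G) (\<lambda>_. complex_units)"

(* The inhomogeneous 2-cocycles and 2-coboundaries for the trivial action of G on the
   multiplicative group of nonzero complex numbers; they are not required to be normalised. *)

definition cocycles2 :: "('a, 'b) monoid_scheme \<Rightarrow> ('a \<times> 'a \<Rightarrow> complex) set" where
  "cocycles2 G =
     {f \<in> carrier (cochain_group2 G).
        \<forall>x\<in>carrier G. \<forall>y\<in>carrier G. \<forall>z\<in>carrier G.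
          f (x, y) * f (x \<otimes>\<^bsub>G\<^esub> y, z) = f (y, z) * f (x, y \<otimes>\<^bsub>G\<^esub> z)}"

definition coboundaries2 :: "('a, 'b) monoid_scheme \<Rightarrow> ('a \<times> 'a \<Rightarrow> complex) set" where
  "coboundaries2 G =
     (\<lambda>c. \<lambda>(x, y)\<in>carrier G \<times> carrier G. c x * c y / c (x \<otimes>\<^bsub>G\<^esub> y)) ` (carrier G \<rightarrow> - {0})"

definition schur_multiplier :: "('a, 'b) monoid_scheme \<Rightarrow> ('a \<times> 'a \<Rightarrow> complex) set monoid" where
  "schur_multiplier G = (cochain_group2 G)\<lparr>carrier := cocycles2 G\<rparr> Mod coboundaries2 G"

definition min_generators :: "('a, 'b) monoid_scheme \<Rightarrow> nat" where
  "min_generators G =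
     (LEAST r. \<exists>S. S \<subseteq> carrier G \<and> finite S \<and> card S = r \<and> generate G S = carrier G)"

abbreviation commutator_subgroup :: "('a, 'b) monoid_scheme \<Rightarrow> 'a set" where
  "commutator_subgroup G \<equiv> derived G (carrier G)"

abbreviation abelianization :: "('a, 'b) monoid_scheme \<Rightarrow> 'a set monoid" where
  "abelianization G \<equiv> G Mod commutator_subgroup G"

(* Only finite groups matter here: finitely many factors, each of finite order m > 0
   (integer_mod_group 0 would be the infinite cyclic group). *)
definition homocyclic :: "('a, 'b) monoid_scheme \<Rightarrow> bool" where
  "homocyclic H \<longleftrightarrow>
     (\<exists>(r::nat) (m::nat). m > 0 \<and> H \<cong> product_group {1..r} (\<lambda>_. integer_mod_group m))"


lemma complex_units_simps [simp]:
  "carrier complex_units = - {0}" "monoid.mult complex_units = (*)" "one complex_units = 1"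
  by (simp_all add: complex_units_def)

lemma comm_group_complex_units: "comm_group complex_units"
proof (rule comm_groupI)
  fix x assume "x \<in> carrier complex_units"
  then show "\<exists>y\<in>carrier complex_units. y \<otimes>\<^bsub>complex_units\<^esub> x = \<one>\<^bsub>complex_units\<^esub>"
    by (intro bexI[of _ "inverse x"]) auto
qed (auto simp: mult.assoc mult.commute)

lemma inv_complex_units: "x \<noteq> 0 \<Longrightarrow> inv\<^bsub>complex_units\<^esub> x = inverse x"
  by (rule group.inv_equality[OF comm_group.axioms(2)[OF comm_group_complex_units]]) auto

lemma comm_group_cochain_group2: "comm_group (cochain_group2 G)"
proof -
  have grp: "group complex_units"
    using comm_group_complex_units by (rule comm_group.axioms(2))
  have "group (cochain_group2 G)"
    unfolding cochain_group2_def using grp by simp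
  then show ?thesis
    by (rule group.group_comm_groupI) (auto simp: cochain_group2_def mult.commute)
qed

lemma inv_cochain_group2:
  assumes "f \<in> carrier (cochain_group2 G)"
  shows "inv\<^bsub>cochain_group2 G\<^esub> f = (\<lambda>u\<in>carrier G \<times> carrier G. inverse (f u))"
proof -
  have grp: "group complex_units"
    using comm_group_complex_units by (rule comm_group.axioms(2))
  have "inv\<^bsub>cochain_group2 G\<^esub> f = (\<lambda>u\<in>carrier G \<times> carrier G. inv\<^bsub>complex_units\<^esub> (f u))"
    unfolding cochain_group2_def using assms grp
    by (intro inv_product_group) (auto simp: cochain_group2_def)
  also have "\<dots> = (\<lambda>u\<in>carrier G \<times> carrier G. inverse (f u))"
    using assms by (intro restrict_ext inv_complex_units) (auto simp: cochain_group2_def PiE_def Pi_def)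
  finally show ?thesis .
qed

lemma subgroup_cocycles2:
  assumes "group G"
  shows "subgroup (cocycles2 G) (cochain_group2 G)"
proof -
  interpret G: group G by fact
  interpret C: comm_group "cochain_group2 G" by (rule comm_group_cochain_group2)
  show ?thesis
  proof (rule C.subgroupI)
    show "cocycles2 G \<subseteq> carrier (cochain_group2 G)"
      by (auto simp: cocycles2_def)
    have "\<one>\<^bsub>cochain_group2 G\<^esub> \<in> cocycles2 G"
      using C.one_closed by (auto simp: cocycles2_def cochain_group2_def)
    then show "cocycles2 G \<noteq> {}" by blast
  next
    fix f assume f: "f \<in> cocycles2 G"
    then have fc: "f \<in> carrier (cochain_group2 G)" by (simp add: cocycles2_def)
    have e: "inverse (f (x, y)) * inverse (f (x \<otimes>\<^bsub>G\<^esub> y, z)) =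
        inverse (f (y, z)) * inverse (f (x, y \<otimes>\<^bsub>G\<^esub> z))"
      if "x \<in> carrier G" "y \<in> carrier G" "z \<in> carrier G" for x y z
      using f that unfolding cocycles2_def by (simp flip: inverse_mult_distrib)
    have ic: "inv\<^bsub>cochain_group2 G\<^esub> f \<in> carrier (cochain_group2 G)"
      using fc by simp
    show "inv\<^bsub>cochain_group2 G\<^esub> f \<in> cocycles2 G"
      using ic e unfolding cocycles2_def inv_cochain_group2[OF fc] by simp
  next
    fix f g assume f: "f \<in> cocycles2 G" and g: "g \<in> cocycles2 G"
    then have mc: "f \<otimes>\<^bsub>cochain_group2 G\<^esub> g \<in> carrier (cochain_group2 G)"
      by (intro C.m_closed) (auto simp: cocycles2_def)
    have e: "(f (x, y) * g (x, y)) * (f (x \<otimes>\<^bsub>G\<^esub> y, z) * g (x \<otimes>\<^bsub>G\<^esub> y, z)) =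
        (f (y, z) * g (y, z)) * (f (x, y \<otimes>\<^bsub>G\<^esub> z) * g (x, y \<otimes>\<^bsub>G\<^esub> z))"
      if xyz: "x \<in> carrier G" "y \<in> carrier G" "z \<in> carrier G" for x y z
    proof -
      have "f (x, y) * f (x \<otimes>\<^bsub>G\<^esub> y, z) = f (y, z) * f (x, y \<otimes>\<^bsub>G\<^esub> z)"
        "g (x, y) * g (x \<otimes>\<^bsub>G\<^esub> y, z) = g (y, z) * g (x, y \<otimes>\<^bsub>G\<^esub> z)"
        using f g xyz by (auto simp: cocycles2_def)
      then have "(f (x, y) * f (x \<otimes>\<^bsub>G\<^esub> y, z)) * (g (x, y) * g (x \<otimes>\<^bsub>G\<^esub> y, z)) =
          (f (y, z) * f (x, y \<otimes>\<^bsub>G\<^esub> z)) * (g (y, z) * g (x, y \<otimes>\<^bsub>G\<^esub> z))"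
        by (rule arg_cong2)
      then show ?thesis by (simp only: ac_simps)
    qed
    show "f \<otimes>\<^bsub>cochain_group2 G\<^esub> g \<in> cocycles2 G"
      using mc e by (simp add: cocycles2_def) (simp add: cochain_group2_def)
  qed
qed

lemma coboundaries2_subset_cocycles2:
  assumes "group G"
  shows "coboundaries2 G \<subseteq> cocycles2 G"
proof -
  interpret G: group G by fact
  show ?thesis
    unfolding coboundaries2_def cocycles2_def cochain_group2_def
    by (auto simp: Pi_def G.m_assoc) (metis (full_types))+
qed

lemma subgroup_coboundaries2:
  assumes "group G"
  shows "subgroup (coboundaries2 G) (cochain_group2 G)"
proof -
  interpret G: group G by fact
  interpret C: comm_group "cochain_group2 G" by (rule comm_group_cochain_group2)
  have sub: "coboundaries2 G \<subseteq> carrier (cochain_group2 G)"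
    using coboundaries2_subset_cocycles2[OF assms] by (auto simp: cocycles2_def)
  show ?thesis
  proof (rule C.subgroupI[OF sub])
    have "(\<lambda>_. 1) \<in> carrier G \<rightarrow> - {0 :: complex}" by auto
    then show "coboundaries2 G \<noteq> {}"
      unfolding coboundaries2_def by blast
  next
    fix f assume f: "f \<in> coboundaries2 G"
    then obtain c where c: "c \<in> carrier G \<rightarrow> - {0}"
      and fc: "f = (\<lambda>(x, y)\<in>carrier G \<times> carrier G. c x * c y / c (x \<otimes>\<^bsub>G\<^esub> y))"
      by (auto simp: coboundaries2_def)
    have "inv\<^bsub>cochain_group2 G\<^esub> f = (\<lambda>u\<in>carrier G \<times> carrier G. inverse (f u))"
      using f sub by (intro inv_cochain_group2) auto
    also have "\<dots> = (\<lambda>(x, y)\<in>carrier G \<times> carrier G.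
        inverse (c x) * inverse (c y) / inverse (c (x \<otimes>\<^bsub>G\<^esub> y)))"
      by (auto simp: fc fun_eq_iff field_simps)
    finally show "inv\<^bsub>cochain_group2 G\<^esub> f \<in> coboundaries2 G"
      unfolding coboundaries2_def using c
      by (intro image_eqI[of _ _ "\<lambda>x. inverse (c x)"]) auto
  next
    fix f g assume "f \<in> coboundaries2 G" "g \<in> coboundaries2 G"
    then obtain c b where cb: "c \<in> carrier G \<rightarrow> - {0}" "b \<in> carrier G \<rightarrow> - {0}"
      and fg: "f = (\<lambda>(x, y)\<in>carrier G \<times> carrier G. c x * c y / c (x \<otimes>\<^bsub>G\<^esub> y))"
        "g = (\<lambda>(x, y)\<in>carrier G \<times> carrier G. b x * b y / b (x \<otimes>\<^bsub>G\<^esub> y))"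
      by (auto simp: coboundaries2_def)
    have "f \<otimes>\<^bsub>cochain_group2 G\<^esub> g = (\<lambda>(x, y)\<in>carrier G \<times> carrier G.
        (c x * b x) * (c y * b y) / (c (x \<otimes>\<^bsub>G\<^esub> y) * b (x \<otimes>\<^bsub>G\<^esub> y)))"
      by (auto simp: fg fun_eq_iff cochain_group2_def)
    then show "f \<otimes>\<^bsub>cochain_group2 G\<^esub> g \<in> coboundaries2 G"
      unfolding coboundaries2_def using cb
      by (intro image_eqI[of _ _ "\<lambda>x. c x * b x"]) auto
  qed
qed

lemma comm_group_schur_multiplier:
  assumes "group G"
  shows "comm_group (schur_multiplier G)"
proof -
  interpret C: comm_group "cochain_group2 G" by (rule comm_group_cochain_group2)
  interpret Z: comm_group "(cochain_group2 G)\<lparr>carrier := cocycles2 G\<rparr>"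
    by (rule group.group_comm_groupI[OF C.subgroup_imp_group[OF subgroup_cocycles2[OF assms]]])
      (auto simp: cocycles2_def C.m_comm)
  have "subgroup (coboundaries2 G) ((cochain_group2 G)\<lparr>carrier := cocycles2 G\<rparr>)"
    by (rule C.subgroup_incl[OF subgroup_coboundaries2[OF assms] subgroup_cocycles2[OF assms]
          coboundaries2_subset_cocycles2[OF assms]])
  then show ?thesis
    unfolding schur_multiplier_def by (rule Z.abelian_FactGroup)
qed

end

(*
  For a surjection \<pi> from G to H whose kernel is central and generated by an element c of order m,
  a cocycle f of G yields the homomorphism x \<mapsto> f (x, c) / f (c, x) to the m-th roots of unity.
  If it is trivial, f is cohomologous to an inflation from H; if c lies in the commutator subgroup,
  transgression makes the kernel of inflation have order at least m. Hence |M(G)| m \<le> |M(H)| m^t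
  when the homomorphism is determined by its values at t elements.

  For a product of cyclic groups, splitting off one factor at a time gives
  |M(G^ab)| \<le> p^(\<Sum> (i - 1) \<alpha>_i). For G, dividing by central subgroups of order p in the commutator
  subgroup costs a factor p^(d-1) at each step, with t = d. In the last step the commutator
  subgroup has order p and t = 2 is enough: if the homomorphism is trivial at u and v with
  [u, v] \<noteq> 1, it is trivial everywhere, because conjugation by any element fixes the commutator of
  the lifts of u and v to the central extension given by f. Altogether
  |M(G)| \<le> |M(G^ab)| p^((d-1)(k-1)+1).
*)

theory Submission
  imports Defs
begin

section \<open>Cocycles\<close>

text \<open>Spending p^(d-1) on all k reduction steps would give the exponent (d-1)k, which exceeds
  (d-1)(k-1)+1 as soon as d > 2; this is why the last step needs its own argument with a
  noncommuting pair. Since n = k + \<Sum> \<alpha> i, what then remains is 2 \<Sum> (i-1) \<alpha> i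
  \<le> (d-1)(n - k - (\<alpha> 1 - \<alpha> d)). It holds because the smallest cyclic factors,
  which are split off first, receive the largest weights i - 1. Transgression gains a factor m
  because a nontrivial character of the subgroup generated by c cannot extend to G when c lies in
  the commutator subgroup. In the other direction, a cocycle with trivial homomorphism is made
  invariant under c by a recursion along the cosets of that subgroup, and roots of complex numbers
  let the recursion close up. Everything is done with explicit cochains and a counting injection, so
  finiteness of M(G) is obtained together with the bound.\<close>

lemma cocycle_eq:
  assumes "f \<in> cocycles2 G" "x \<in> carrier G" "y \<in> carrier G" "z \<in> carrier G"
  shows "f (x, y) * f (x \<otimes>\<^bsub>G\<^esub> y, z) = f (y, z) * f (x, y \<otimes>\<^bsub>G\<^esub> z)"
  using assms by (simp add: cocycles2_def)

lemma cocycle_nonzero: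
  assumes "f \<in> cocycles2 G" "x \<in> carrier G" "y \<in> carrier G"
  shows "f (x, y) \<noteq> 0"
  using assms by (auto simp: cocycles2_def cochain_group2_def PiE_iff)

lemma cocycleI:
  assumes "f \<in> extensional (carrier G \<times> carrier G)"
    and "\<And>x y. x \<in> carrier G \<Longrightarrow> y \<in> carrier G \<Longrightarrow> f (x, y) \<noteq> 0"
    and "\<And>x y z. x \<in> carrier G \<Longrightarrow> y \<in> carrier G \<Longrightarrow> z \<in> carrier G \<Longrightarrow>
      f (x, y) * f (x \<otimes>\<^bsub>G\<^esub> y, z) = f (y, z) * f (x, y \<otimes>\<^bsub>G\<^esub> z)"
  shows "f \<in> cocycles2 G"
  using assms by (auto simp: cocycles2_def cochain_group2_def PiE_iff)

lemma cocycle_extensional: "f \<in> cocycles2 G \<Longrightarrow> f \<in> extensional (carrier G \<times> carrier G)"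
  by (auto simp: cocycles2_def cochain_group2_def PiE_iff)

lemma coboundaryI:
  assumes "f \<in> extensional (carrier G \<times> carrier G)"
    and "\<And>x. x \<in> carrier G \<Longrightarrow> c x \<noteq> 0"
    and "\<And>x y. x \<in> carrier G \<Longrightarrow> y \<in> carrier G \<Longrightarrow> f (x, y) = c x * c y / c (x \<otimes>\<^bsub>G\<^esub> y)"
  shows "f \<in> coboundaries2 G"
proof -
  have "f = (\<lambda>(x, y)\<in>carrier G \<times> carrier G. c x * c y / c (x \<otimes>\<^bsub>G\<^esub> y))"
    using assms(3) by (intro extensionalityI[OF assms(1)]) auto
  then show ?thesis
    unfolding coboundaries2_def using assms(2) by (intro image_eqI[of _ _ c]) auto
qed

lemma coboundaryE:
  assumes "f \<in> coboundaries2 G"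
  obtains c where "\<And>x. x \<in> carrier G \<Longrightarrow> c x \<noteq> 0"
    and "\<And>x y. x \<in> carrier G \<Longrightarrow> y \<in> carrier G \<Longrightarrow> f (x, y) = c x * c y / c (x \<otimes>\<^bsub>G\<^esub> y)"
proof -
  obtain c where "c \<in> carrier G \<rightarrow> - {0}"
    "f = (\<lambda>(x, y)\<in>carrier G \<times> carrier G. c x * c y / c (x \<otimes>\<^bsub>G\<^esub> y))"
    using assms unfolding coboundaries2_def by blast
  then show thesis by (intro that[of c]) auto
qed

abbreviation cocycle_group2 :: "('a, 'b) monoid_scheme \<Rightarrow> ('a \<times> 'a \<Rightarrow> complex) monoid" where
  "cocycle_group2 G \<equiv> (cochain_group2 G)\<lparr>carrier := cocycles2 G\<rparr>"

lemma comm_group_cocycle_group2: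
  assumes "group G"
  shows "comm_group (cocycle_group2 G)"
proof -
  interpret C: comm_group "cochain_group2 G" by (rule comm_group_cochain_group2)
  show ?thesis
    by (rule group.group_comm_groupI[OF C.subgroup_imp_group[OF subgroup_cocycles2[OF assms]]])
      (auto simp: cocycles2_def C.m_comm)
qed

lemma subgroup_coboundaries2_cocycle_group2:
  assumes "group G"
  shows "subgroup (coboundaries2 G) (cocycle_group2 G)"
proof -
  interpret C: comm_group "cochain_group2 G" by (rule comm_group_cochain_group2)
  show ?thesis
    by (rule C.subgroup_incl[OF subgroup_coboundaries2[OF assms] subgroup_cocycles2[OF assms]
          coboundaries2_subset_cocycles2[OF assms]])
qed

lemma mult_cocycle_group2:
  "f \<otimes>\<^bsub>cocycle_group2 G\<^esub> g = (\<lambda>u\<in>carrier G \<times> carrier G. f u * g u)"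
  by (simp add: cochain_group2_def)

lemma inv_cocycle_group2:
  assumes "group G" "f \<in> cocycles2 G"
  shows "inv\<^bsub>cocycle_group2 G\<^esub> f = (\<lambda>u\<in>carrier G \<times> carrier G. inverse (f u))"
proof -
  interpret C: comm_group "cochain_group2 G" by (rule comm_group_cochain_group2)
  have "inv\<^bsub>cocycle_group2 G\<^esub> f = inv\<^bsub>cochain_group2 G\<^esub> f"
    by (rule C.m_inv_consistent[OF subgroup_cocycles2[OF assms(1)] assms(2)])
  also have "\<dots> = (\<lambda>u\<in>carrier G \<times> carrier G. inverse (f u))"
    using assms(2) by (intro inv_cochain_group2) (auto simp: cocycles2_def)
  finally show ?thesis .
qed

lemma quotient_cocycle:
  assumes "group G" "f \<in> cocycles2 G" "g \<in> cocycles2 G"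
  shows "f \<otimes>\<^bsub>cocycle_group2 G\<^esub> inv\<^bsub>cocycle_group2 G\<^esub> g =
    (\<lambda>u\<in>carrier G \<times> carrier G. f u / g u)"
  unfolding inv_cocycle_group2[OF assms(1,3)] mult_cocycle_group2
  by (simp add: fun_eq_iff divide_inverse)

section \<open>Values at the identity and the commutator pairing\<close>

context group begin

text \<open>Cocycles are not normalised, so these values need not be 1. Cancelling a nonzero factor
  in the cocycle identity with two arguments equal to \<one> shows that they agree, which is enough
  to make \<open>f (x, \<one>) / f (\<one>, x)\<close> trivial.\<close>

lemma cocycle_one:
  assumes f: "f \<in> cocycles2 G" and x: "x \<in> carrier G"
  shows "f (\<one>, x) = f (\<one>, \<one>)" "f (x, \<one>) = f (\<one>, \<one>)"
  using cocycle_eq[OF f one_closed one_closed x] cocycle_eq[OF f x one_closed one_closed]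
    cocycle_nonzero[OF f one_closed x] cocycle_nonzero[OF f x one_closed] x by simp_all

text \<open>In the central extension of \<open>G\<close> by the nonzero complex numbers defined by the cocycle
  \<open>f\<close>, the quotient \<open>f (x, y) / f (y, x)\<close> is the commutator of lifts of commuting
  elements \<open>x\<close> and \<open>y\<close>.\<close>

lemma commutator_pairing_mult_left:
  assumes f: "f \<in> cocycles2 G" and xyc: "x \<in> carrier G" "y \<in> carrier G" "c \<in> carrier G"
    and "x \<otimes> c = c \<otimes> x" "y \<otimes> c = c \<otimes> y"
  shows "f (x \<otimes> y, c) / f (c, x \<otimes> y) = (f (x, c) / f (c, x)) * (f (y, c) / f (c, y))"
proof -
  \<comment> \<open>The three identities put \<open>c\<close> to the right of, between and to the
    left of \<open>x\<close> and \<open>y\<close>. The outer two give the quotient up to a factor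
    that the middle one evaluates.\<close>
  have 1: "f (x, y) * f (x \<otimes> y, c) = f (y, c) * f (x, c \<otimes> y)"
    using cocycle_eq[OF f, of x y c] assms by simp
  have 2: "f (x, c) * f (c \<otimes> x, y) = f (c, y) * f (x, c \<otimes> y)"
    using cocycle_eq[OF f, of x c y] assms by simp
  have 3: "f (c, x) * f (c \<otimes> x, y) = f (x, y) * f (c, x \<otimes> y)"
    using cocycle_eq[OF f, of c x y] assms by simp
  have nz: "f (x, y) \<noteq> 0" "f (c, x) \<noteq> 0" "f (c, y) \<noteq> 0" "f (c, x \<otimes> y) \<noteq> 0" "f (c \<otimes> x, y) \<noteq> 0"
    "f (x, c \<otimes> y) \<noteq> 0"
    using xyc by (simp_all add: cocycle_nonzero[OF f])
  have "f (x \<otimes> y, c) / f (c, x \<otimes> y) = (f (y, c) * f (x, c \<otimes> y)) / (f (c, x) * f (c \<otimes> x, y))"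
    using nz by (simp add: 3 flip: 1)
  also have "\<dots> = (f (y, c) / f (c, x)) * (f (x, c \<otimes> y) / f (c \<otimes> x, y))"
    by simp
  also have "f (x, c \<otimes> y) / f (c \<otimes> x, y) = f (x, c) / f (c, y)"
    using 2 nz by (simp add: frac_eq_eq mult.commute)
  finally show ?thesis by (simp add: mult.commute)
qed

text \<open>Swapping the arguments inverts the pairing, so multiplicativity in the first argument
  carries over to the second. With \<open>i\<close> the order of \<open>c\<close> it shows that the
  pairing takes roots of unity as values.\<close>

lemma commutator_pairing_pow_right:
  assumes f: "f \<in> cocycles2 G" and xc: "x \<in> carrier G" "c \<in> carrier G" and "x \<otimes> c = c \<otimes> x"
  shows "f (x, c [^] i) / f (c [^] i, x) = (f (x, c) / f (c, x)) ^ (i::nat)"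
proof (induction i)
  case 0
  then show ?case using cocycle_one[OF f xc(1)] cocycle_nonzero[OF f one_closed one_closed] by simp
next
  case (Suc i)
  have com: "c [^] i \<otimes> x = x \<otimes> c [^] i"
    using assms by (metis group_commutes_pow)
  have "f (c [^] Suc i, x) / f (x, c [^] Suc i) =
      (f (c [^] i, x) / f (x, c [^] i)) * (f (c, x) / f (x, c))"
    using commutator_pairing_mult_left[OF f, of "c [^] i" c x] com assms by simp
  then have "inverse (f (c [^] Suc i, x) / f (x, c [^] Suc i)) =
      inverse ((f (c [^] i, x) / f (x, c [^] i)) * (f (c, x) / f (x, c)))" by simp
  also have "\<dots> = (f (x, c [^] i) / f (c [^] i, x)) * (f (x, c) / f (c, x))" by simp
  finally show ?case unfolding Suc.IH by simp
qed

end

section \<open>Bounds for quotient groups\<close>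

text \<open>Applied to the cocycle groups \<open>K\<close> of G and \<open>L\<close> of H modulo
  coboundaries, with \<open>h\<close> inflation, \<open>\<phi>\<close> the tuple of pairing values
  and \<open>x\<close> the transgressed classes. The assumption \<open>exact\<close> stands for
  exactness at the middle of L/M, K/N, V, and \<open>x\<close> supplies \<open>m\<close> classes
  killed by \<open>h\<close>. The explicit injection yields finiteness as well as the
  inequality.\<close>

lemma FactGroup_card_bound:
  fixes m :: nat
  assumes K: "comm_group K" and N: "subgroup N K"
    and L: "comm_group L" and M: "subgroup M L"
    and h: "h \<in> hom L K" "h ` M \<subseteq> N"
    and fin: "finite (carrier (L Mod M))"
    and \<phi>: "\<phi> ` carrier K \<subseteq> V" "finite V"
    and exact: "\<And>k l. k \<in> carrier K \<Longrightarrow> l \<in> carrier K \<Longrightarrow> \<phi> k = \<phi> l \<Longrightarrow>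
      \<exists>y\<in>carrier L. (k \<otimes>\<^bsub>K\<^esub> inv\<^bsub>K\<^esub> l) \<otimes>\<^bsub>K\<^esub> inv\<^bsub>K\<^esub> (h y) \<in> N"
    and m: "m > 0"
    and x: "\<And>i. i < m \<Longrightarrow> x i \<in> carrier L" "\<And>i. i < m \<Longrightarrow> h (x i) \<in> N"
      "\<And>i j. i < m \<Longrightarrow> j < m \<Longrightarrow> x i \<otimes>\<^bsub>L\<^esub> inv\<^bsub>L\<^esub> x j \<in> M \<Longrightarrow> i = j"
  shows "finite (carrier (K Mod N)) \<and> order (K Mod N) * m \<le> order (L Mod M) * card V"
proof -
  interpret K: comm_group K by fact
  interpret L: comm_group L by fact
  interpret N: subgroup N K by fact
  interpret M: subgroup M L by fact
  interpret h: group_hom L K h using h(1) by unfold_locales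
  have coset_iff: "N #>\<^bsub>K\<^esub> a = N #>\<^bsub>K\<^esub> b \<longleftrightarrow> a \<otimes>\<^bsub>K\<^esub> inv\<^bsub>K\<^esub> b \<in> N"
    if "a \<in> carrier K" "b \<in> carrier K" for a b
    using that N.rcos_module[OF K.is_group, of b a] K.repr_independence[OF _ _ N.subgroup_axioms, of a b]
      K.rcos_self[OF _ N.subgroup_axioms, of a] by metis
  have coset_iffL: "M #>\<^bsub>L\<^esub> a = M #>\<^bsub>L\<^esub> b \<longleftrightarrow> a \<otimes>\<^bsub>L\<^esub> inv\<^bsub>L\<^esub> b \<in> M"
    if "a \<in> carrier L" "b \<in> carrier L" for a b
    using that M.rcos_module[OF L.is_group, of b a] L.repr_independence[OF _ _ M.subgroup_axioms, of a b]
      L.rcos_self[OF _ M.subgroup_axioms, of a] by metis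
  define r where "r Y = (SOME k. k \<in> carrier K \<and> Y = N #>\<^bsub>K\<^esub> k)" for Y
  have r: "r Y \<in> carrier K" "Y = N #>\<^bsub>K\<^esub> r Y" if "Y \<in> carrier (K Mod N)" for Y
    using someI_ex[of "\<lambda>k. k \<in> carrier K \<and> Y = N #>\<^bsub>K\<^esub> k"] that
    by (auto simp: r_def FactGroup_def RCOSETS_def)
  \<comment> \<open>A base point in each fibre of \<open>\<phi>\<close>; \<open>y k\<close> then
    measures \<open>k\<close> relative to the base point of its fibre.\<close>
  define l where "l v = (SOME k. k \<in> carrier K \<and> \<phi> k = v)" for v
  have l: "l (\<phi> k) \<in> carrier K" "\<phi> (l (\<phi> k)) = \<phi> k" if "k \<in> carrier K" for k
    using someI_ex[of "\<lambda>k'. k' \<in> carrier K \<and> \<phi> k' = \<phi> k"] that by (auto simp: l_def)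
  have "\<exists>y\<in>carrier L. (k \<otimes>\<^bsub>K\<^esub> inv\<^bsub>K\<^esub> l (\<phi> k)) \<otimes>\<^bsub>K\<^esub> inv\<^bsub>K\<^esub> (h y) \<in> N" if "k \<in> carrier K" for k
    using that l[OF that] by (intro exact) auto
  then obtain y where y: "\<And>k. k \<in> carrier K \<Longrightarrow> y k \<in> carrier L"
    "\<And>k. k \<in> carrier K \<Longrightarrow> (k \<otimes>\<^bsub>K\<^esub> inv\<^bsub>K\<^esub> l (\<phi> k)) \<otimes>\<^bsub>K\<^esub> inv\<^bsub>K\<^esub> (h (y k)) \<in> N"
    by metis
  \<comment> \<open>The second component determines the base point, the first the position relative
    to it. Shifting by \<open>x i\<close> is invisible after applying \<open>h\<close>, so it does
    not disturb the recovery of \<open>Y\<close>.\<close>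
  define \<Theta> where "\<Theta> = (\<lambda>(Y, i). (M #>\<^bsub>L\<^esub> (x i \<otimes>\<^bsub>L\<^esub> y (r Y)), \<phi> (r Y)))"
  have im: "\<Theta> ` (carrier (K Mod N) \<times> {..<m}) \<subseteq> carrier (L Mod M) \<times> V"
  proof (rule image_subsetI)
    fix z assume "z \<in> carrier (K Mod N) \<times> {..<m}"
    then obtain Y i where z: "z = (Y, i)" and Y: "Y \<in> carrier (K Mod N)" and i: "i < m" by auto
    have "x i \<otimes>\<^bsub>L\<^esub> y (r Y) \<in> carrier L" "\<phi> (r Y) \<in> V"
      using r(1)[OF Y] y(1) x(1)[OF i] \<phi>(1) by auto
    then show "\<Theta> z \<in> carrier (L Mod M) \<times> V"
      unfolding z \<Theta>_def FactGroup_def RCOSETS_def by auto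
  qed
  have inj: "inj_on \<Theta> (carrier (K Mod N) \<times> {..<m})"
  proof (rule inj_onI)
    fix z z' assume "z \<in> carrier (K Mod N) \<times> {..<m}" "z' \<in> carrier (K Mod N) \<times> {..<m}"
      and eqz: "\<Theta> z = \<Theta> z'"
    then obtain Y i Z j where z: "z = (Y, i)" "z' = (Z, j)"
      and Y: "Y \<in> carrier (K Mod N)" and Z: "Z \<in> carrier (K Mod N)" and i: "i < m" and j: "j < m"
      by auto
    have eq: "\<Theta> (Y, i) = \<Theta> (Z, j)" using eqz unfolding z .
    define k k' where "k = r Y" and "k' = r Z"
    have k: "k \<in> carrier K" "k' \<in> carrier K" using r Y Z by (auto simp: k_def k'_def)
    have eq1: "M #>\<^bsub>L\<^esub> (x i \<otimes>\<^bsub>L\<^esub> y k) = M #>\<^bsub>L\<^esub> (x j \<otimes>\<^bsub>L\<^esub> y k')" and eq2: "\<phi> k = \<phi> k'"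
      using eq by (auto simp: \<Theta>_def k_def k'_def)
    note yk = y(1)[OF k(1)] y(1)[OF k(2)] and xi = x(1)[OF i] x(1)[OF j]
    have "(x i \<otimes>\<^bsub>L\<^esub> y k) \<otimes>\<^bsub>L\<^esub> inv\<^bsub>L\<^esub> (x j \<otimes>\<^bsub>L\<^esub> y k') \<in> M"
      using eq1 coset_iffL yk xi by simp
    then have "h ((x i \<otimes>\<^bsub>L\<^esub> y k) \<otimes>\<^bsub>L\<^esub> inv\<^bsub>L\<^esub> (x j \<otimes>\<^bsub>L\<^esub> y k')) \<in> N"
      using h(2) by blast
    then have 1: "(h (x i) \<otimes>\<^bsub>K\<^esub> h (y k)) \<otimes>\<^bsub>K\<^esub> inv\<^bsub>K\<^esub> (h (x j) \<otimes>\<^bsub>K\<^esub> h (y k')) \<in> N"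
      using yk xi by simp
    define a a' b b' u where ab: "a = h (x i)" "a' = h (x j)" "b = h (y k)" "b' = h (y k')"
      "u = l (\<phi> k)"
    have cl: "a \<in> carrier K" "a' \<in> carrier K" "b \<in> carrier K" "b' \<in> carrier K" "u \<in> carrier K"
      using yk xi l k by (auto simp: ab)
    have N1: "(a \<otimes>\<^bsub>K\<^esub> b) \<otimes>\<^bsub>K\<^esub> inv\<^bsub>K\<^esub> (a' \<otimes>\<^bsub>K\<^esub> b') \<in> N"
      using 1 by (simp add: ab)
    have N2: "(k \<otimes>\<^bsub>K\<^esub> inv\<^bsub>K\<^esub> u) \<otimes>\<^bsub>K\<^esub> inv\<^bsub>K\<^esub> b \<in> N" "(k' \<otimes>\<^bsub>K\<^esub> inv\<^bsub>K\<^esub> u) \<otimes>\<^bsub>K\<^esub> inv\<^bsub>K\<^esub> b' \<in> N"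
      using y(2)[OF k(1)] y(2)[OF k(2)] eq2 by (auto simp: ab)
    define n1 n2 n3 where n: "n1 = (k \<otimes>\<^bsub>K\<^esub> inv\<^bsub>K\<^esub> u) \<otimes>\<^bsub>K\<^esub> inv\<^bsub>K\<^esub> b"
      "n2 = (k' \<otimes>\<^bsub>K\<^esub> inv\<^bsub>K\<^esub> u) \<otimes>\<^bsub>K\<^esub> inv\<^bsub>K\<^esub> b'"
      "n3 = (a \<otimes>\<^bsub>K\<^esub> b) \<otimes>\<^bsub>K\<^esub> inv\<^bsub>K\<^esub> (a' \<otimes>\<^bsub>K\<^esub> b')"
    have nN: "n1 \<in> N" "n2 \<in> N" "n3 \<in> N" "a \<in> N" "a' \<in> N"
      using N1 N2 x(2) i j by (auto simp: n ab)
    note nK = this[THEN N.mem_carrier]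
    have e1: "k = n1 \<otimes>\<^bsub>K\<^esub> b \<otimes>\<^bsub>K\<^esub> u" "k' = n2 \<otimes>\<^bsub>K\<^esub> b' \<otimes>\<^bsub>K\<^esub> u"
      "a \<otimes>\<^bsub>K\<^esub> b = n3 \<otimes>\<^bsub>K\<^esub> (a' \<otimes>\<^bsub>K\<^esub> b')"
      unfolding n using k cl by (simp_all add: K.m_assoc)
    \<comment> \<open>Modulo \<open>N\<close> the elements \<open>a\<close> and \<open>a'\<close>
      vanish, so \<open>b\<close> and \<open>b'\<close> agree, and \<open>k\<close> and
      \<open>k'\<close> are both congruent to \<open>b\<close> times \<open>u\<close>.\<close>
    have "k \<otimes>\<^bsub>K\<^esub> (n2 \<otimes>\<^bsub>K\<^esub> a) = (n1 \<otimes>\<^bsub>K\<^esub> u \<otimes>\<^bsub>K\<^esub> n2) \<otimes>\<^bsub>K\<^esub> (a \<otimes>\<^bsub>K\<^esub> b)"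
      unfolding e1(1) using nK cl by (simp add: K.m_ac)
    also have "\<dots> = (n1 \<otimes>\<^bsub>K\<^esub> n3 \<otimes>\<^bsub>K\<^esub> a') \<otimes>\<^bsub>K\<^esub> k'"
      unfolding e1(3) unfolding e1(2) using nK cl by (simp add: K.m_ac)
    finally have "k \<otimes>\<^bsub>K\<^esub> (n2 \<otimes>\<^bsub>K\<^esub> a) = (n1 \<otimes>\<^bsub>K\<^esub> n3 \<otimes>\<^bsub>K\<^esub> a') \<otimes>\<^bsub>K\<^esub> k'" .
    then have "k = (n1 \<otimes>\<^bsub>K\<^esub> n3 \<otimes>\<^bsub>K\<^esub> a') \<otimes>\<^bsub>K\<^esub> k' \<otimes>\<^bsub>K\<^esub> inv\<^bsub>K\<^esub> (n2 \<otimes>\<^bsub>K\<^esub> a)"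
      using K.inv_solve_right k nK by simp
    then have "k \<otimes>\<^bsub>K\<^esub> inv\<^bsub>K\<^esub> k' =
        (n1 \<otimes>\<^bsub>K\<^esub> n3 \<otimes>\<^bsub>K\<^esub> a') \<otimes>\<^bsub>K\<^esub> k' \<otimes>\<^bsub>K\<^esub> inv\<^bsub>K\<^esub> (n2 \<otimes>\<^bsub>K\<^esub> a) \<otimes>\<^bsub>K\<^esub> inv\<^bsub>K\<^esub> k'"
      by (rule arg_cong)
    also have "\<dots> = (n1 \<otimes>\<^bsub>K\<^esub> n3 \<otimes>\<^bsub>K\<^esub> a') \<otimes>\<^bsub>K\<^esub> inv\<^bsub>K\<^esub> (n2 \<otimes>\<^bsub>K\<^esub> a)"
      using k nK K.inv_solve_right'[of "(n1 \<otimes>\<^bsub>K\<^esub> n3 \<otimes>\<^bsub>K\<^esub> a') \<otimes>\<^bsub>K\<^esub> inv\<^bsub>K\<^esub> (n2 \<otimes>\<^bsub>K\<^esub> a)"]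
      by (simp add: K.m_assoc K.m_comm[of k' "inv\<^bsub>K\<^esub> (n2 \<otimes>\<^bsub>K\<^esub> a)"])
    also have "\<dots> \<in> N" using nN by simp
    finally have "N #>\<^bsub>K\<^esub> k = N #>\<^bsub>K\<^esub> k'" using coset_iff k by simp
    then have YZ: "Y = Z" using r Y Z by (simp add: k_def k'_def)
    then have "k = k'" by (simp add: k_def k'_def)
    \<comment> \<open>With equal representatives the two values of \<open>y\<close> cancel, leaving
      only the separation of the classes of \<open>x i\<close> and \<open>x j\<close>.\<close>
    then have "(x i \<otimes>\<^bsub>L\<^esub> y k) \<otimes>\<^bsub>L\<^esub> inv\<^bsub>L\<^esub> (x j \<otimes>\<^bsub>L\<^esub> y k) \<in> M"
      using eq1 coset_iffL yk xi by simp
    also have "(x i \<otimes>\<^bsub>L\<^esub> y k) \<otimes>\<^bsub>L\<^esub> inv\<^bsub>L\<^esub> (x j \<otimes>\<^bsub>L\<^esub> y k) = x i \<otimes>\<^bsub>L\<^esub> inv\<^bsub>L\<^esub> x j"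
      using yk xi by (simp add: L.inv_mult_group L.m_assoc) (simp flip: L.m_assoc)
    finally show "z = z'" unfolding z using x(3) i j YZ by simp
  qed
  have finp: "finite (carrier (L Mod M) \<times> V)" using fin \<phi>(2) by simp
  have "finite (carrier (K Mod N) \<times> {..<m})"
    by (rule inj_on_finite[OF inj im finp])
  then have "finite (carrier (K Mod N))"
    using m by (auto dest: finite_cartesian_productD1)
  moreover have "order (K Mod N) * m \<le> order (L Mod M) * card V"
    using card_inj_on_le[OF inj im finp] by (simp add: card_cartesian_product order_def)
  ultimately show ?thesis by simp
qed

section \<open>Central extensions with cyclic kernel\<close>

text \<open>\<open>H\<close> has its own element type, so that truncation of a product, passage to
  coset representatives and the map onto the abelianization can all be instances. Listing the kernel
  as powers with exponents below \<open>m\<close> presents each fibre as a cycle of length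
  \<open>m\<close>.\<close>

locale cyclic_central_extension = G: group G + H: group H for G (structure) and H +
  fixes \<pi> c and m :: nat
  assumes hom: "\<pi> \<in> hom G H" and surj: "\<pi> ` carrier G = carrier H"
    and c [simp]: "c \<in> carrier G" and central: "\<And>x. x \<in> carrier G \<Longrightarrow> x \<otimes> c = c \<otimes> x"
    and m_pos: "m > 0" and ord_c: "G.ord c = m"
    and kernel: "\<And>x. x \<in> carrier G \<Longrightarrow> \<pi> x = \<one>\<^bsub>H\<^esub> \<longleftrightarrow> (\<exists>i<m. x = c [^] (i::nat))"
begin

sublocale group_hom G H \<pi> using hom by unfold_locales

lemma c_pow_m [simp]: "c [^] m = \<one>"
  using G.pow_ord_eq_1[OF c] ord_c by simp

lemma \<pi>_c [simp]: "\<pi> c = \<one>\<^bsub>H\<^esub>"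
proof (cases "m = 1")
  \<comment> \<open>The exponent 1 is not below \<open>m\<close> here, so \<open>kernel\<close> does
    not list \<open>c\<close> as its first power; but \<open>c\<close> is the identity.\<close>
  case True
  then show ?thesis using c_pow_m by simp
next
  case False
  then have "1 < m" "c = c [^] (1::nat)" using m_pos by simp_all
  then show ?thesis using kernel[OF c] by blast
qed

lemma c_pow_inj: "i < m \<Longrightarrow> j < m \<Longrightarrow> c [^] i = c [^] j \<Longrightarrow> i = j"
  using inj_onD[OF G.ord_inj[OF c], of i j] ord_c by simp

lemma fiber:
  assumes "x \<in> carrier G" "y \<in> carrier G" "\<pi> x = \<pi> y"
  shows "\<exists>i<m. y = x \<otimes> c [^] i"
proof -
  have "\<pi> (inv x \<otimes> y) = \<one>\<^bsub>H\<^esub>" using assms by simp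
  then obtain i where "i < m" "inv x \<otimes> y = c [^] i" using kernel[of "inv x \<otimes> y"] assms by blast
  moreover have "y = x \<otimes> (inv x \<otimes> y)" using assms by (simp flip: G.m_assoc)
  ultimately show ?thesis by metis
qed

lemma ex_preimage: "Z \<in> carrier H \<Longrightarrow> \<exists>x. x \<in> carrier G \<and> \<pi> x = Z"
  unfolding surj[symmetric] by blast

lemma ex_representatives:
  obtains r where "\<And>Z. Z \<in> carrier H \<Longrightarrow> r Z \<in> carrier G" "\<And>Z. Z \<in> carrier H \<Longrightarrow> \<pi> (r Z) = Z"
proof (rule that[of "\<lambda>Z. SOME x. x \<in> carrier G \<and> \<pi> x = Z"])
  fix Z assume "Z \<in> carrier H"
  note some = someI_ex[OF ex_preimage[OF this]]
  show "(SOME x. x \<in> carrier G \<and> \<pi> x = Z) \<in> carrier G"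
    by (rule conjunct1[OF some])
  show "\<pi> (SOME x. x \<in> carrier G \<and> \<pi> x = Z) = Z"
    by (rule conjunct2[OF some])
qed

lemma invariant_imp_constant_on_fibers:
  assumes "\<And>x. x \<in> carrier G \<Longrightarrow> F (x \<otimes> c) = F x" "x \<in> carrier G" "y \<in> carrier G" "\<pi> x = \<pi> y"
  shows "F x = F y"
proof -
  have pow: "F (x \<otimes> c [^] i) = F x" for i :: nat
  proof (induction i)
    case 0
    then show ?case using assms(2) by simp
  next
    case (Suc i)
    have "F (x \<otimes> c [^] Suc i) = F (x \<otimes> c [^] i \<otimes> c)" using assms(2) by (simp add: G.m_assoc)
    also have "\<dots> = F (x \<otimes> c [^] i)" using assms(2) by (intro assms(1)) simp
    finally show ?case using Suc.IH by simp
  qed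
  obtain i where "y = x \<otimes> c [^] (i::nat)" using fiber[OF assms(2-4)] by blast
  then show ?thesis using pow[of i] by simp
qed

text \<open>Each fibre of \<open>\<pi>\<close> is a cycle under multiplication by \<open>c\<close>.
  A recursion prescribing the ratio of consecutive values can be solved around the cycle when the
  product of all ratios is 1.\<close>

lemma ex_quasiperiodic:
  fixes \<rho> :: "_ \<Rightarrow> complex"
  assumes nz: "\<And>x. x \<in> carrier G \<Longrightarrow> \<rho> x \<noteq> 0"
    and prod: "\<And>x. x \<in> carrier G \<Longrightarrow> (\<Prod>i<m. \<rho> (x \<otimes> c [^] i)) = 1"
  obtains b where "\<And>x. x \<in> carrier G \<Longrightarrow> b x \<noteq> 0"
    "\<And>x. x \<in> carrier G \<Longrightarrow> b (x \<otimes> c) = b x * \<rho> x"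
proof -
  obtain r where r: "\<And>Z. Z \<in> carrier H \<Longrightarrow> r Z \<in> carrier G" "\<And>Z. Z \<in> carrier H \<Longrightarrow> \<pi> (r Z) = Z"
    by (rule ex_representatives) blast
  define t where "t x = r (\<pi> x)" for x
  have t: "t x \<in> carrier G" "\<pi> (t x) = \<pi> x" if "x \<in> carrier G" for x
    using r that by (auto simp: t_def)
  have "\<forall>x. \<exists>i. x \<in> carrier G \<longrightarrow> i < m \<and> x = t x \<otimes> c [^] i"
    using fiber t by blast
  then obtain k where k: "\<And>x. x \<in> carrier G \<Longrightarrow> k x < m" "\<And>x. x \<in> carrier G \<Longrightarrow> x = t x \<otimes> c [^] k x"
    by metis
  \<comment> \<open>\<open>k x\<close> is the position of \<open>x\<close> in its cycle, counted
    from the representative \<open>t x\<close>, where \<open>b\<close> starts with the empty product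
    1.\<close>
  define b where "b x = (\<Prod>j<k x. \<rho> (t x \<otimes> c [^] j))" for x
  show thesis
  proof
    fix x assume x: "x \<in> carrier G"
    show "b x \<noteq> 0" using t[OF x] by (auto simp: b_def nz)
    have xc: "x \<otimes> c \<in> carrier G" using x by simp
    have tc: "t (x \<otimes> c) = t x" using x by (simp add: t_def)
    have e1: "t x \<otimes> c [^] k (x \<otimes> c) = x \<otimes> c" using k(2)[OF xc] unfolding tc by (rule sym)
    have e2: "x \<otimes> c = t x \<otimes> c [^] k x \<otimes> c" by (rule arg_cong[OF k(2)[OF x]])
    have e3: "t x \<otimes> c [^] k x \<otimes> c = t x \<otimes> c [^] Suc (k x)"
      using t[OF x] by (simp add: G.m_assoc)
    have eq: "c [^] k (x \<otimes> c) = c [^] Suc (k x)"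
      by (rule G.l_cancel[OF trans[OF e1 trans[OF e2 e3]]]) (use t[OF x] in simp_all)
    have "b x * \<rho> (t x \<otimes> c [^] k x) = (\<Prod>j<Suc (k x). \<rho> (t x \<otimes> c [^] j))"
      by (simp add: b_def)
    then have b_Suc: "b x * \<rho> x = (\<Prod>j<Suc (k x). \<rho> (t x \<otimes> c [^] j))"
      by (simp only: k(2)[OF x, symmetric])
    show "b (x \<otimes> c) = b x * \<rho> x"
    proof (cases "Suc (k x) < m")
      case True
      then have "k (x \<otimes> c) = Suc (k x)" using c_pow_inj[OF k(1)[OF xc] True eq] by simp
      then show ?thesis unfolding b_Suc by (simp only: b_def tc)
    next
      case False
      \<comment> \<open>The last element of the cycle: multiplying by \<open>c\<close> returns to
        the representative, and the recursion closes because the full product is 1.\<close>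
      then have Suc: "Suc (k x) = m" using k(1)[OF x] by simp
      have "c [^] k (x \<otimes> c) = c [^] (0::nat)" unfolding eq Suc by simp
      then have "k (x \<otimes> c) = 0"
        by (rule c_pow_inj[OF k(1)[OF xc] m_pos])
      then have "b (x \<otimes> c) = 1" by (simp add: b_def)
      then show ?thesis unfolding b_Suc Suc prod[OF t(1)[OF x]] .
    qed
  qed
qed

section \<open>Inflation of cocycles and descent to the quotient\<close>

definition inflation :: "('c \<times> 'c \<Rightarrow> complex) \<Rightarrow> 'a \<times> 'a \<Rightarrow> complex" where
  "inflation F = (\<lambda>(x, y)\<in>carrier G \<times> carrier G. F (\<pi> x, \<pi> y))"

lemma inflation_cocycle:
  assumes "F \<in> cocycles2 H"
  shows "inflation F \<in> cocycles2 G"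
  by (rule cocycleI) (use assms in \<open>auto simp: inflation_def cocycle_nonzero cocycle_eq\<close>)

lemma inflation_hom: "inflation \<in> hom (cocycle_group2 H) (cocycle_group2 G)"
proof (rule homI)
  fix E F assume "E \<in> carrier (cocycle_group2 H)" "F \<in> carrier (cocycle_group2 H)"
  then show "inflation (E \<otimes>\<^bsub>cocycle_group2 H\<^esub> F) =
      inflation E \<otimes>\<^bsub>cocycle_group2 G\<^esub> inflation F"
    unfolding mult_cocycle_group2 by (auto simp: inflation_def fun_eq_iff)
qed (simp add: inflation_cocycle)

lemma inflation_coboundary:
  assumes "F \<in> coboundaries2 H"
  shows "inflation F \<in> coboundaries2 G"
proof -
  obtain b where "\<And>x. x \<in> carrier H \<Longrightarrow> b x \<noteq> 0"
    "\<And>x y. x \<in> carrier H \<Longrightarrow> y \<in> carrier H \<Longrightarrow> F (x, y) = b x * b y / b (x \<otimes>\<^bsub>H\<^esub> y)"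
    using coboundaryE[OF assms] by metis
  then show ?thesis
    by (intro coboundaryI[where c = "\<lambda>x. b (\<pi> x)"]) (auto simp: inflation_def)
qed

text \<open>Invariance under the generator of the kernel gives constancy on fibres. Evaluation at
  representatives is then independent of their choice and inherits the cocycle identity from
  arbitrary preimages.\<close>

lemma ex_inflation:
  assumes F: "F \<in> cocycles2 G"
    and inv: "\<And>x y. x \<in> carrier G \<Longrightarrow> y \<in> carrier G \<Longrightarrow> F (x \<otimes> c, y) = F (x, y)"
      "\<And>x y. x \<in> carrier G \<Longrightarrow> y \<in> carrier G \<Longrightarrow> F (x, y \<otimes> c) = F (x, y)"
  obtains E where "E \<in> cocycles2 H" "inflation E = F"
proof -
  obtain r where r: "\<And>Z. Z \<in> carrier H \<Longrightarrow> r Z \<in> carrier G" "\<And>Z. Z \<in> carrier H \<Longrightarrow> \<pi> (r Z) = Z"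
    by (rule ex_representatives) blast
  have eq: "F (x, y) = F (x', y')"
    if "x \<in> carrier G" "y \<in> carrier G" "x' \<in> carrier G" "y' \<in> carrier G" "\<pi> x = \<pi> x'" "\<pi> y = \<pi> y'"
    for x y x' y'
  proof -
    have "F (x, y) = F (x', y)"
      using invariant_imp_constant_on_fibers[of "\<lambda>x. F (x, y)" x x'] that inv by auto
    also have "\<dots> = F (x', y')"
      using invariant_imp_constant_on_fibers[of "\<lambda>y. F (x', y)" y y'] that inv by auto
    finally show ?thesis .
  qed
  define E where "E = (\<lambda>(Z, Y)\<in>carrier H \<times> carrier H. F (r Z, r Y))"
  have E: "E (\<pi> x, \<pi> y) = F (x, y)" if "x \<in> carrier G" "y \<in> carrier G" for x y
    using that r by (auto simp: E_def intro!: eq)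
  show thesis
  proof
    show "E \<in> cocycles2 H"
    proof (rule cocycleI)
      fix W Y Z assume "W \<in> carrier H" "Y \<in> carrier H" "Z \<in> carrier H"
      then obtain x y z where xyz: "x \<in> carrier G" "y \<in> carrier G" "z \<in> carrier G"
        and WYZ: "W = \<pi> x" "Y = \<pi> y" "Z = \<pi> z" using ex_preimage by metis
      have "W \<otimes>\<^bsub>H\<^esub> Y = \<pi> (x \<otimes> y)" "Y \<otimes>\<^bsub>H\<^esub> Z = \<pi> (y \<otimes> z)"
        using xyz by (simp_all add: WYZ)
      then show "E (W, Y) * E (W \<otimes>\<^bsub>H\<^esub> Y, Z) = E (Y, Z) * E (W, Y \<otimes>\<^bsub>H\<^esub> Z)"
        unfolding WYZ using cocycle_eq[OF F, of x y z] xyz by (simp add: E del: hom_mult)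
    qed (use r in \<open>auto simp: E_def cocycle_nonzero[OF F]\<close>)
    show "inflation E = F"
      using cocycle_extensional[OF F]
      by (auto simp: inflation_def fun_eq_iff E extensional_def)
  qed
qed

end

section \<open>Roots of complex numbers, exactness and transgression\<close>

lemma ex_complex_root:
  assumes "m > 0"
  obtains z :: complex where "z ^ m = w"
proof
  show "rcis (root m (cmod w)) (Arg w / real m) ^ m = w"
    using assms by (simp add: DeMoivre2 rcis_cmod_Arg)
qed

lemma ex_primitive_root_of_unity:
  assumes "m > 0"
  obtains w :: complex where "w \<noteq> 0" "w ^ m = 1"
    "\<And>i j. i < m \<Longrightarrow> j < m \<Longrightarrow> w ^ i = w ^ j \<Longrightarrow> i = j"
proof
  let ?w = "cis (2 * pi / real m)"
  show "?w \<noteq> 0" by simp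
  have pow: "?w ^ k = cis (2 * pi * real k / real m)" for k
    by (simp add: DeMoivre mult.commute)
  show "?w ^ m = 1" unfolding pow using assms by simp
  fix i j assume ij: "i < m" "j < m" "?w ^ i = ?w ^ j"
  have "inj_on (\<lambda>k. cis (2 * pi * real k / real m)) {..<m}"
    using Complex.bij_betw_roots_unity[OF assms] by (rule bij_betw_imp_inj_on)
  from inj_onD[OF this, of i j] show "i = j" using ij(3) ij(1,2) unfolding pow by simp
qed

lemma (in group) hom_derived_trivial:
  assumes A: "comm_group A" and h: "h \<in> hom G A" and x: "x \<in> derived G (carrier G)"
  shows "h x = \<one>\<^bsub>A\<^esub>"
proof -
  interpret A: comm_group A by fact
  interpret h: group_hom G A h using h by unfold_locales
  have "h ` derived G (carrier G) = derived A (h ` carrier G)"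
    by (rule h.derived_img[symmetric]) simp
  also have "\<dots> = {\<one>\<^bsub>A\<^esub>}" by (rule A.derived_eq_singleton) auto
  finally show ?thesis using x by blast
qed

context cyclic_central_extension begin

lemma twisted_cocycle:
  assumes f: "f \<in> cocycles2 G" and b: "\<And>x. x \<in> carrier G \<Longrightarrow> b x \<noteq> 0"
  shows "(\<lambda>(x, y)\<in>carrier G \<times> carrier G. f (x, y) * (b x * b y / b (x \<otimes> y))) \<in> cocycles2 G"
    (is "?F \<in> _")
proof (rule cocycleI)
  fix x y z assume xyz: "x \<in> carrier G" "y \<in> carrier G" "z \<in> carrier G"
  have "?F (x, y) * ?F (x \<otimes> y, z) =
      (f (x, y) * f (x \<otimes> y, z)) * (b x * b y * b z / b (x \<otimes> y \<otimes> z))"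
    using xyz b[of "x \<otimes> y"] by simp
  also have "\<dots> = (f (y, z) * f (x, y \<otimes> z)) * (b x * b y * b z / b (x \<otimes> (y \<otimes> z)))"
    using cocycle_eq[OF f xyz] xyz by (simp add: G.m_assoc)
  also have "\<dots> = ?F (y, z) * ?F (x, y \<otimes> z)"
    using xyz b[of "y \<otimes> z"] by simp
  finally show "?F (x, y) * ?F (x \<otimes> y, z) = ?F (y, z) * ?F (x, y \<otimes> z)" .
qed (use assms in \<open>auto simp: cocycle_nonzero[OF f]\<close>)

text \<open>The cocycle identity at \<open>x\<close>, \<open>c [^] i\<close>, \<open>c\<close>
  telescopes, and after \<open>m\<close> steps the boundary terms are both
  \<open>f (x, \<one>)\<close>. Independence of \<open>x\<close> is what lets one scalar serve all
  fibres in \<open>inflation_exact\<close>.\<close>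

lemma prod_cocycle_over_kernel:
  assumes f: "f \<in> cocycles2 G" and x: "x \<in> carrier G"
  shows "(\<Prod>i<m. f (x \<otimes> c [^] i, c)) = (\<Prod>i<m. f (c [^] i, c))"
proof -
  have "f (x, \<one>) * (\<Prod>i<n. f (x \<otimes> c [^] i, c)) = (\<Prod>i<n. f (c [^] i, c)) * f (x, c [^] n)" for n :: nat
  proof (induction n)
    case (Suc n)
    have "f (x, \<one>) * (\<Prod>i<Suc n. f (x \<otimes> c [^] i, c)) =
        (f (x, \<one>) * (\<Prod>i<n. f (x \<otimes> c [^] i, c))) * f (x \<otimes> c [^] n, c)" by simp
    also have "\<dots> = (\<Prod>i<n. f (c [^] i, c)) * (f (x, c [^] n) * f (x \<otimes> c [^] n, c))"
      unfolding Suc.IH by simp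
    also have "\<dots> = (\<Prod>i<Suc n. f (c [^] i, c)) * f (x, c [^] Suc n)"
      using cocycle_eq[OF f x, of "c [^] n" c] by simp
    finally show ?case .
  qed simp
  from this[of m] show ?thesis using cocycle_nonzero[OF f x G.one_closed] by simp
qed

text \<open>Multiplying \<open>f\<close> by the coboundary of a function \<open>b\<close> with
  \<open>b (x \<otimes> c) = b x * (s * f (x, c))\<close> makes it invariant under the kernel. The constant \<open>s\<close> is
  chosen so that the recursion closes up after \<open>m\<close> steps.\<close>

lemma inflation_exact:
  assumes f: "f \<in> cocycles2 G" and com: "\<And>x. x \<in> carrier G \<Longrightarrow> f (x, c) = f (c, x)"
  obtains E where "E \<in> cocycles2 H"
    "f \<otimes>\<^bsub>cocycle_group2 G\<^esub> inv\<^bsub>cocycle_group2 G\<^esub> inflation E \<in> coboundaries2 G"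
proof -
  define Q where "Q = (\<Prod>i<m. f (c [^] i, c))"
  have Q: "Q \<noteq> 0" by (auto simp: Q_def cocycle_nonzero[OF f])
  obtain s where s: "s ^ m = inverse Q" using ex_complex_root[OF m_pos] .
  have s0: "s \<noteq> 0" using s Q m_pos by (auto simp: power_0_left)
  obtain b where b: "\<And>x. x \<in> carrier G \<Longrightarrow> b x \<noteq> 0"
    "\<And>x. x \<in> carrier G \<Longrightarrow> b (x \<otimes> c) = b x * (s * f (x, c))"
  proof (rule ex_quasiperiodic[of "\<lambda>x. s * f (x, c)"])
    fix x assume x: "x \<in> carrier G"
    show "s * f (x, c) \<noteq> 0" using s0 cocycle_nonzero[OF f x c] by simp
    have "(\<Prod>i<m. s * f (x \<otimes> c [^] i, c)) = s ^ m * (\<Prod>i<m. f (x \<otimes> c [^] i, c))"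
      by (simp add: prod.distrib)
    also have "\<dots> = 1" unfolding prod_cocycle_over_kernel[OF f x] s Q_def[symmetric] using Q by simp
    finally show "(\<Prod>i<m. s * f (x \<otimes> c [^] i, c)) = 1" .
  qed blast
  define F where "F = (\<lambda>(x, y)\<in>carrier G \<times> carrier G. f (x, y) * (b x * b y / b (x \<otimes> y)))"
  have F: "F \<in> cocycles2 G" unfolding F_def by (rule twisted_cocycle[OF f b(1)])
  have right: "F (x, y \<otimes> c) = F (x, y)" if xy: "x \<in> carrier G" "y \<in> carrier G" for x y
  proof -
    have "b (x \<otimes> (y \<otimes> c)) = b (x \<otimes> y) * (s * f (x \<otimes> y, c))"
      using b(2)[of "x \<otimes> y"] xy by (simp add: G.m_assoc)
    then have "F (x, y \<otimes> c) = (f (y, c) * f (x, y \<otimes> c)) * (s * b x * b y) / (b (x \<otimes> y) * (s * f (x \<otimes> y, c)))"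
      using xy b(2)[OF xy(2)] by (simp add: F_def mult_ac)
    also have "\<dots> = F (x, y)"
      using cocycle_eq[OF f xy c, symmetric] xy s0 cocycle_nonzero[OF f, of "x \<otimes> y" c]
      by (simp add: F_def)
    finally show ?thesis .
  qed
  \<comment> \<open>Here the symmetry \<open>com\<close> enters: it replaces \<open>f (c, y)\<close>
    by \<open>f (y, c)\<close>, linking the cocycle identities at \<open>x, c, y\<close> and
    \<open>x, y, c\<close>.\<close>
  have left: "F (x \<otimes> c, y) = F (x, y)" if xy: "x \<in> carrier G" "y \<in> carrier G" for x y
  proof -
    have eq: "x \<otimes> c \<otimes> y = x \<otimes> y \<otimes> c" "c \<otimes> y = y \<otimes> c"
      using xy central[OF xy(2)] by (simp_all add: G.m_assoc)
    have "f (x, c) * f (x \<otimes> c, y) = f (y, c) * f (x, y \<otimes> c)"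
      using cocycle_eq[OF f xy(1) c xy(2)] com[OF xy(2)] eq by simp
    also have "\<dots> = f (x, y) * f (x \<otimes> y, c)"
      using cocycle_eq[OF f xy c] by simp
    finally have e: "f (x, c) * f (x \<otimes> c, y) = f (x, y) * f (x \<otimes> y, c)" .
    have "F (x \<otimes> c, y) = (f (x, c) * f (x \<otimes> c, y)) * (s * b x * b y) / (b (x \<otimes> y) * (s * f (x \<otimes> y, c)))"
      using xy b(2)[OF xy(1)] b(2)[of "x \<otimes> y"] by (simp add: F_def mult_ac eq)
    also have "\<dots> = F (x, y)"
      unfolding e using xy s0 cocycle_nonzero[OF f, of "x \<otimes> y" c] by (simp add: F_def)
    finally show ?thesis .
  qed
  obtain E where E: "E \<in> cocycles2 H" "inflation E = F"
    using ex_inflation[OF F left right] .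
  have "f \<otimes>\<^bsub>cocycle_group2 G\<^esub> inv\<^bsub>cocycle_group2 G\<^esub> F \<in> coboundaries2 G"
    unfolding quotient_cocycle[OF G.is_group f F]
  \<comment> \<open>\<open>F\<close> is \<open>f\<close> times the coboundary of \<open>b\<close>,
    so the quotient is the coboundary of the reciprocal.\<close>
  proof (rule coboundaryI[where c = "\<lambda>x. inverse (b x)"])
    fix x y assume xy: "x \<in> carrier G" "y \<in> carrier G"
    then show "(\<lambda>u\<in>carrier G \<times> carrier G. f u / F u) (x, y) =
        inverse (b x) * inverse (b y) / inverse (b (x \<otimes> y))"
      using b(1) cocycle_nonzero[OF f xy] by (simp add: F_def field_simps)
  qed (use b(1) in auto)
  with E show thesis by (intro that) auto
qed

text \<open>A function \<open>u\<close> multiplied by a primitive root \<open>w\<close> under each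
  step by \<open>c\<close> need not be a homomorphism, but the coboundaries of its powers are
  constant on fibres and descend to \<open>H\<close>. These are the transgressions of the characters
  sending \<open>c\<close> to \<open>w ^ i\<close>. If two of them were cohomologous on
  \<open>H\<close>, the quotient character would extend to \<open>G\<close>, yet homomorphisms to
  abelian groups are trivial on the commutator subgroup.\<close>

lemma ex_transgressions:
  assumes "c \<in> derived G (carrier G)"
  obtains E where "\<And>i. E i \<in> cocycles2 H" "\<And>i. inflation (E i) \<in> coboundaries2 G"
    "\<And>i j. i < m \<Longrightarrow> j < m \<Longrightarrow>
      E i \<otimes>\<^bsub>cocycle_group2 H\<^esub> inv\<^bsub>cocycle_group2 H\<^esub> E j \<in> coboundaries2 H \<Longrightarrow> i = j"
proof -
  obtain w :: complex where w: "w \<noteq> 0" "w ^ m = 1"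
    "\<And>i j. i < m \<Longrightarrow> j < m \<Longrightarrow> w ^ i = w ^ j \<Longrightarrow> i = j"
    by (rule ex_primitive_root_of_unity[OF m_pos]) blast
  obtain u where u: "\<And>x. x \<in> carrier G \<Longrightarrow> u x \<noteq> 0" "\<And>x. x \<in> carrier G \<Longrightarrow> u (x \<otimes> c) = u x * w"
    by (rule ex_quasiperiodic[of "\<lambda>_. w"]) (use w in auto)
  define F where "F i = (\<lambda>(x, y)\<in>carrier G \<times> carrier G. u x ^ i * u y ^ i / u (x \<otimes> y) ^ i)" for i :: nat
  have Fcob: "F i \<in> coboundaries2 G" for i
    by (rule coboundaryI[where c = "\<lambda>x. u x ^ i"]) (use u in \<open>auto simp: F_def\<close>)
  then have Fcoc: "F i \<in> cocycles2 G" for i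
    using coboundaries2_subset_cocycles2[OF G.is_group] by blast
  have "\<exists>E. E \<in> cocycles2 H \<and> inflation E = F i" for i
  proof -
    have "F i (x \<otimes> c, y) = F i (x, y)" "F i (x, y \<otimes> c) = F i (x, y)"
      if xy: "x \<in> carrier G" "y \<in> carrier G" for x y
    proof -
      have "x \<otimes> c \<otimes> y = x \<otimes> y \<otimes> c" "x \<otimes> (y \<otimes> c) = x \<otimes> y \<otimes> c"
        using xy central[OF xy(2)] by (simp_all add: G.m_assoc)
      then show "F i (x \<otimes> c, y) = F i (x, y)" "F i (x, y \<otimes> c) = F i (x, y)"
        using xy u(2) w(1) by (simp_all add: F_def power_mult_distrib)
    qed
    then show ?thesis using ex_inflation[OF Fcoc] by metis
  qed
  then obtain E where E: "\<And>i. E i \<in> cocycles2 H" "\<And>i. inflation (E i) = F i" by metis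
  show thesis
  proof
    show "E i \<in> cocycles2 H" "inflation (E i) \<in> coboundaries2 G" for i
      using E Fcob by auto
    fix i j assume ij: "i < m" "j < m"
      and "E i \<otimes>\<^bsub>cocycle_group2 H\<^esub> inv\<^bsub>cocycle_group2 H\<^esub> E j \<in> coboundaries2 H"
    then have "(\<lambda>u\<in>carrier H \<times> carrier H. E i u / E j u) \<in> coboundaries2 H"
      using quotient_cocycle[OF H.is_group E(1) E(1)] by simp
    then obtain b where b: "\<And>x. x \<in> carrier H \<Longrightarrow> b x \<noteq> 0"
      "\<And>x y. x \<in> carrier H \<Longrightarrow> y \<in> carrier H \<Longrightarrow>
        (\<lambda>u\<in>carrier H \<times> carrier H. E i u / E j u) (x, y) = b x * b y / b (x \<otimes>\<^bsub>H\<^esub> y)"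
      by (rule coboundaryE) blast
    \<comment> \<open>Dividing by the cochain \<open>b\<close> of \<open>H\<close> makes
      \<open>u ^ i / u ^ j\<close> multiplicative, without changing its behaviour under
      multiplication by \<open>c\<close>.\<close>
    define v where "v x = u x ^ i / u x ^ j / b (\<pi> x)" for x
    have E_F: "E k (\<pi> x, \<pi> y) = F k (x, y)" if "x \<in> carrier G" "y \<in> carrier G" for k x y
      using that by (simp add: inflation_def flip: E(2))
    have rearrange: "a3 / c3 / r = (a1 / c1 / p) * (a2 / c2 / q)"
      if "(a1 * a2 / a3) / (c1 * c2 / c3) = p * q / r"
        "a1 \<noteq> 0" "a2 \<noteq> 0" "a3 \<noteq> 0" "c1 \<noteq> 0" "c2 \<noteq> 0" "c3 \<noteq> 0" "p \<noteq> 0" "q \<noteq> 0" "r \<noteq> 0"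
      for a1 a2 a3 c1 c2 c3 p q r :: complex
      using that by (simp add: field_simps)
    have v: "v \<in> hom G complex_units"
    proof (rule homI)
      fix x y assume xy: "x \<in> carrier G" "y \<in> carrier G"
      have "F i (x, y) / F j (x, y) = b (\<pi> x) * b (\<pi> y) / b (\<pi> (x \<otimes> y))"
        using b(2)[of "\<pi> x" "\<pi> y"] xy by (simp add: E_F)
      then have "(u x ^ i * u y ^ i / u (x \<otimes> y) ^ i) / (u x ^ j * u y ^ j / u (x \<otimes> y) ^ j) =
          b (\<pi> x) * b (\<pi> y) / b (\<pi> (x \<otimes> y))"
        using xy by (simp add: F_def del: hom_mult)
      moreover have "u x \<noteq> 0" "u y \<noteq> 0" "u (x \<otimes> y) \<noteq> 0"
        "b (\<pi> x) \<noteq> 0" "b (\<pi> y) \<noteq> 0" "b (\<pi> (x \<otimes> y)) \<noteq> 0"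
        using xy u(1) b(1) by (simp_all del: hom_mult)
      ultimately show "v (x \<otimes> y) = v x \<otimes>\<^bsub>complex_units\<^esub> v y"
        unfolding v_def complex_units_simps by (intro rearrange) simp_all
    qed (use u(1) b(1) in \<open>auto simp: v_def\<close>)
    have "v c = 1"
      using G.hom_derived_trivial[OF comm_group_complex_units v assms] by simp
    moreover have "v \<one> = 1"
      using Group.hom_one[OF v G.is_group comm_group.axioms(2)[OF comm_group_complex_units]] by simp
    moreover have "v c = v \<one> * (w ^ i / w ^ j)"
      using u(2)[of \<one>] by (simp add: v_def power_mult_distrib)
    ultimately have "w ^ i = w ^ j" using w(1) by (simp add: field_simps)
    then show "i = j" by (rule w(3)[OF ij])
  qed
qed

text \<open>A cocycle \<open>f\<close> is mapped to the values \<open>f (t, c) / f (c, t)\<close>, which are \<open>m\<close>-th roots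
  of unity; two cocycles with the same values differ by an inflation up to coboundaries.\<close>

theorem schur_multiplier_bound:
  assumes T: "T \<subseteq> carrier G" "finite T"
    and gen: "\<And>f x. f \<in> cocycles2 G \<Longrightarrow> (\<And>t. t \<in> T \<Longrightarrow> f (t, c) = f (c, t)) \<Longrightarrow>
      x \<in> carrier G \<Longrightarrow> f (x, c) = f (c, x)"
    and fin: "finite (carrier (schur_multiplier H))"
    and m': "m' = (if c \<in> derived G (carrier G) then m else 1)"
  shows "finite (carrier (schur_multiplier G))"
    "order (schur_multiplier G) * m' \<le> order (schur_multiplier H) * m ^ card T"
proof -
  have "\<exists>E. (\<forall>i<m'. E i \<in> cocycles2 H) \<and> (\<forall>i<m'. inflation (E i) \<in> coboundaries2 G) \<and>
    (\<forall>i<m'. \<forall>j<m'. E i \<otimes>\<^bsub>cocycle_group2 H\<^esub> inv\<^bsub>cocycle_group2 H\<^esub> E j \<in> coboundaries2 H \<longrightarrow> i = j)"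
  proof (cases "c \<in> derived G (carrier G)")
    case True
    from ex_transgressions[OF this] obtain E where "\<And>i. E i \<in> cocycles2 H" "\<And>i. inflation (E i) \<in> coboundaries2 G"
      "\<And>i j. i < m \<Longrightarrow> j < m \<Longrightarrow>
        E i \<otimes>\<^bsub>cocycle_group2 H\<^esub> inv\<^bsub>cocycle_group2 H\<^esub> E j \<in> coboundaries2 H \<Longrightarrow> i = j"
      by blast
    then show ?thesis using True m' by (intro exI[of _ E]) auto
  next
    case False
    \<comment> \<open>In this case \<open>m'\<close> is 1, and the family consists of the trivial
      cocycle alone.\<close>
    have one: "\<one>\<^bsub>cocycle_group2 H\<^esub> \<in> coboundaries2 H"
      by (rule subgroup.one_closed[OF subgroup_coboundaries2_cocycle_group2[OF H.is_group]])
    show ?thesis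
      using False m' inflation_coboundary[OF one] coboundaries2_subset_cocycles2[OF H.is_group] one
      by (intro exI[of _ "\<lambda>_. \<one>\<^bsub>cocycle_group2 H\<^esub>"]) auto
  qed
  then obtain E where E: "\<And>i. i < m' \<Longrightarrow> E i \<in> cocycles2 H" "\<And>i. i < m' \<Longrightarrow> inflation (E i) \<in> coboundaries2 G"
    "\<And>i j. i < m' \<Longrightarrow> j < m' \<Longrightarrow>
      E i \<otimes>\<^bsub>cocycle_group2 H\<^esub> inv\<^bsub>cocycle_group2 H\<^esub> E j \<in> coboundaries2 H \<Longrightarrow> i = j"
    by metis
  define \<phi> where "\<phi> f = (\<lambda>t\<in>T. f (t, c) / f (c, t))" for f :: "'a \<times> 'a \<Rightarrow> complex"
  define V where "V = (\<Pi>\<^sub>E t\<in>T. {z::complex. z ^ m = 1})"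
  have V: "finite V" "card V = m ^ card T"
    using T(2) m_pos by (simp_all add: V_def card_PiE finite_PiE finite_roots_unity card_roots_unity_eq)
  have \<phi>_V: "\<phi> ` carrier (cocycle_group2 G) \<subseteq> V"
  proof (rule image_subsetI)
    fix f assume "f \<in> carrier (cocycle_group2 G)"
    then have f: "f \<in> cocycles2 G" by simp
    have "(f (t, c) / f (c, t)) ^ m = 1" if "t \<in> T" for t
    proof -
      have t: "t \<in> carrier G" using that T by blast
      have "(f (t, c) / f (c, t)) ^ m = f (t, \<one>) / f (\<one>, t)"
        using G.commutator_pairing_pow_right[OF f t c central[OF t], of m] by simp
      then show ?thesis
        using G.cocycle_one[OF f t] cocycle_nonzero[OF f, of \<one> \<one>] by simp
    qed
    then show "\<phi> f \<in> V" by (auto simp: \<phi>_def V_def)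
  qed
  have exact: "\<exists>y\<in>carrier (cocycle_group2 H). (f \<otimes>\<^bsub>cocycle_group2 G\<^esub> inv\<^bsub>cocycle_group2 G\<^esub> g)
      \<otimes>\<^bsub>cocycle_group2 G\<^esub> inv\<^bsub>cocycle_group2 G\<^esub> (inflation y) \<in> coboundaries2 G"
    if fg: "f \<in> carrier (cocycle_group2 G)" "g \<in> carrier (cocycle_group2 G)" and eq: "\<phi> f = \<phi> g" for f g
  proof -
    interpret K: comm_group "cocycle_group2 G" by (rule comm_group_cocycle_group2[OF G.is_group])
    define h where "h = f \<otimes>\<^bsub>cocycle_group2 G\<^esub> inv\<^bsub>cocycle_group2 G\<^esub> g"
    have "h \<in> carrier (cocycle_group2 G)" unfolding h_def using fg by (intro K.m_closed K.inv_closed)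
    then have h: "h \<in> cocycles2 G" by simp
    have h_eq: "h = (\<lambda>u\<in>carrier G \<times> carrier G. f u / g u)"
      unfolding h_def using fg by (intro quotient_cocycle) auto
    have "h (t, c) = h (c, t)" if t: "t \<in> T" for t
    proof -
      have tG: "t \<in> carrier G" using t T by blast
      have nz: "f (t, c) \<noteq> 0" "f (c, t) \<noteq> 0" "g (t, c) \<noteq> 0" "g (c, t) \<noteq> 0"
        using fg tG by (auto simp: cocycle_nonzero)
      have "f (t, c) / f (c, t) = g (t, c) / g (c, t)"
        using fun_cong[OF eq, of t] t by (simp add: \<phi>_def)
      then show ?thesis using nz tG by (simp add: h_eq field_simps)
    qed
    then have "h (x, c) = h (c, x)" if "x \<in> carrier G" for x
      using gen[OF h _ that] by blast
    then obtain y where "y \<in> cocycles2 H"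
      "h \<otimes>\<^bsub>cocycle_group2 G\<^esub> inv\<^bsub>cocycle_group2 G\<^esub> inflation y \<in> coboundaries2 G"
      using inflation_exact[OF h] by metis
    then show ?thesis unfolding h_def by auto
  qed
  have "m' > 0" using m' m_pos by simp
  have sub: "inflation ` coboundaries2 H \<subseteq> coboundaries2 G"
    using inflation_coboundary by blast
  have fin': "finite (carrier (cocycle_group2 H Mod coboundaries2 H))"
    using fin by (simp add: schur_multiplier_def)
  have "finite (carrier (cocycle_group2 G Mod coboundaries2 G)) \<and>
    order (cocycle_group2 G Mod coboundaries2 G) * m' \<le>
      order (cocycle_group2 H Mod coboundaries2 H) * card V"
  proof (rule FactGroup_card_bound[where h = inflation and \<phi> = \<phi> and x = E])
    show "E i \<in> carrier (cocycle_group2 H)" "inflation (E i) \<in> coboundaries2 G" if "i < m'" for i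
      using E(1,2)[OF that] by simp_all
    show "i = j" if "i < m'" "j < m'"
      "E i \<otimes>\<^bsub>cocycle_group2 H\<^esub> inv\<^bsub>cocycle_group2 H\<^esub> E j \<in> coboundaries2 H" for i j
      by (rule E(3)[OF that])
    show "\<exists>y\<in>carrier (cocycle_group2 H). (f \<otimes>\<^bsub>cocycle_group2 G\<^esub> inv\<^bsub>cocycle_group2 G\<^esub> g)
      \<otimes>\<^bsub>cocycle_group2 G\<^esub> inv\<^bsub>cocycle_group2 G\<^esub> (inflation y) \<in> coboundaries2 G"
      if "f \<in> carrier (cocycle_group2 G)" "g \<in> carrier (cocycle_group2 G)" "\<phi> f = \<phi> g" for f g
      by (rule exact[OF that])
  qed (fact comm_group_cocycle_group2[OF G.is_group] subgroup_coboundaries2_cocycle_group2[OF G.is_group]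
      comm_group_cocycle_group2[OF H.is_group] subgroup_coboundaries2_cocycle_group2[OF H.is_group]
      inflation_hom sub fin' \<phi>_V V(1) \<open>m' > 0\<close>)+
  then show "finite (carrier (schur_multiplier G))"
    "order (schur_multiplier G) * m' \<le> order (schur_multiplier H) * m ^ card T"
    by (simp_all add: schur_multiplier_def V(2))
qed

end

text \<open>Pairing with \<open>c\<close> is a homomorphism, so its kernel is a subgroup. It
  contains \<open>c\<close> itself for free, hence \<open>T\<close> only has to generate together
  with \<open>c\<close>; this saves one generator for products of cyclic groups.\<close>

lemma (in cyclic_central_extension) symmetric_on_generators:
  assumes f: "f \<in> cocycles2 G" and T: "T \<subseteq> carrier G" "generate G (insert c T) = carrier G"
    and sym: "\<And>t. t \<in> T \<Longrightarrow> f (t, c) = f (c, t)" and x: "x \<in> carrier G"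
  shows "f (x, c) = f (c, x)"
proof -
  define l where "l x = f (x, c) / f (c, x)" for x
  have l_hom: "l \<in> hom G complex_units"
  proof (rule homI)
    fix x y assume xy: "x \<in> carrier G" "y \<in> carrier G"
    show "l (x \<otimes> y) = l x \<otimes>\<^bsub>complex_units\<^esub> l y"
      unfolding l_def complex_units_simps
      by (rule G.commutator_pairing_mult_left[OF f xy c central[OF xy(1)] central[OF xy(2)]])
  qed (simp add: l_def cocycle_nonzero[OF f])
  interpret l: group_hom G complex_units l
    by (intro group_hom.intro group_hom_axioms.intro G.is_group l_hom
        comm_group.axioms(2)[OF comm_group_complex_units])
  have "insert c T \<subseteq> kernel G complex_units l"
    using T(1) sym cocycle_nonzero[OF f] by (auto simp: kernel_def l_def subset_eq)
  then have "generate G (insert c T) \<subseteq> kernel G complex_units l"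
    by (rule G.generate_subgroup_incl[OF _ l.subgroup_kernel])
  then have "l x = 1" using x T(2) by (auto simp: kernel_def)
  then show ?thesis using cocycle_nonzero[OF f c x] by (simp add: l_def)
qed

lemma schur_multiplier_trivial_group:
  assumes "group G" "carrier G = {\<one>\<^bsub>G\<^esub>}"
  shows "finite (carrier (schur_multiplier G))" "order (schur_multiplier G) = 1"
proof -
  interpret G: group G by fact
  interpret K: comm_group "cocycle_group2 G" by (rule comm_group_cocycle_group2[OF assms(1)])
  interpret B: subgroup "coboundaries2 G" "cocycle_group2 G"
    by (rule subgroup_coboundaries2_cocycle_group2[OF assms(1)])
  have "cocycles2 G \<subseteq> coboundaries2 G"
  proof
    fix f assume f: "f \<in> cocycles2 G"
    show "f \<in> coboundaries2 G"
    \<comment> \<open>A constant a is the coboundary of the constant function a, as a * a / a =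
      a.\<close>
    proof (rule coboundaryI[where c = "\<lambda>_. f (\<one>\<^bsub>G\<^esub>, \<one>\<^bsub>G\<^esub>)"])
      fix x y assume "x \<in> carrier G" "y \<in> carrier G"
      then have "x = \<one>\<^bsub>G\<^esub>" "y = \<one>\<^bsub>G\<^esub>" using assms(2) by auto
      then show "f (x, y) = f (\<one>\<^bsub>G\<^esub>, \<one>\<^bsub>G\<^esub>) * f (\<one>\<^bsub>G\<^esub>, \<one>\<^bsub>G\<^esub>) / f (\<one>\<^bsub>G\<^esub>, \<one>\<^bsub>G\<^esub>)"
        by simp
    qed (use cocycle_nonzero[OF f] cocycle_extensional[OF f] in auto)
  qed
  then have *: "coboundaries2 G #>\<^bsub>cocycle_group2 G\<^esub> f = coboundaries2 G" if "f \<in> cocycles2 G" for f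
    using B.rcos_const[OF K.is_group] that by blast
  have "carrier (schur_multiplier G) = (\<lambda>f. coboundaries2 G #>\<^bsub>cocycle_group2 G\<^esub> f) ` cocycles2 G"
    by (auto simp: schur_multiplier_def FactGroup_def RCOSETS_def)
  also have "\<dots> = {coboundaries2 G}"
    using * K.one_closed by auto
  finally show "finite (carrier (schur_multiplier G))" "order (schur_multiplier G) = 1"
    by (simp_all add: order_def)
qed

section \<open>Products of cyclic groups\<close>

abbreviation (input) cyclic_product :: "(nat \<Rightarrow> nat) \<Rightarrow> nat \<Rightarrow> (nat \<Rightarrow> int) monoid" where
  "cyclic_product q d \<equiv> product_group {1..d} (\<lambda>i. integer_mod_group (q i))"

text \<open>The reduction of 1 modulo \<open>q i\<close> covers trivial factors: for
  \<open>q i = 1\<close> the entry must be 0.\<close>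

definition unit_vector :: "(nat \<Rightarrow> nat) \<Rightarrow> nat \<Rightarrow> nat \<Rightarrow> nat \<Rightarrow> int" where
  "unit_vector q d j = (\<lambda>i\<in>{1..d}. if i = j then 1 mod int (q i) else 0)"

lemma group_cyclic_product: "group (cyclic_product q d)"
  by simp

lemma unit_vector_carrier:
  assumes "\<And>i. q i > 0"
  shows "unit_vector q d j \<in> carrier (cyclic_product q d)"
  using assms by (auto simp: unit_vector_def carrier_integer_mod_group)

lemma pow_unit_vector:
  "unit_vector q d j [^]\<^bsub>cyclic_product q d\<^esub> (n::nat) =
    (\<lambda>i\<in>{1..d}. if i = j then int n mod int (q i) else 0)"
proof (induction n)
  case (Suc n)
  have "unit_vector q d j [^]\<^bsub>cyclic_product q d\<^esub> Suc n =
      unit_vector q d j [^]\<^bsub>cyclic_product q d\<^esub> n \<otimes>\<^bsub>cyclic_product q d\<^esub> unit_vector q d j"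
    by (rule nat_pow_Suc)
  also have "\<dots> = (\<lambda>i\<in>{1..d}. if i = j then int (Suc n) mod int (q i) else 0)"
    unfolding Suc.IH by (auto simp: unit_vector_def fun_eq_iff mod_simps add.commute)
  finally show ?case .
qed (auto simp: fun_eq_iff)

lemma generate_unit_vectors:
  assumes q: "\<And>i. q i > 0"
  shows "generate (cyclic_product q d) (unit_vector q d ` {1..d}) = carrier (cyclic_product q d)"
proof -
  interpret A: group "cyclic_product q d" by (rule group_cyclic_product)
  have sub: "unit_vector q d ` {1..d} \<subseteq> carrier (cyclic_product q d)"
    using unit_vector_carrier[of q d] q by blast
  interpret W: subgroup "generate (cyclic_product q d) (unit_vector q d ` {1..d})" "cyclic_product q d"
    by (rule A.generate_is_subgroup[OF sub])
  have "x \<in> generate (cyclic_product q d) (unit_vector q d ` {1..d})"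
    if x: "x \<in> carrier (cyclic_product q d)" for x
  proof -
    have xi: "0 \<le> x i" "x i < int (q i)" if "i \<in> {1..d}" for i
      using PiE_mem[OF x[unfolded carrier_product_group] that] q[of i]
      by (simp_all add: carrier_integer_mod_group)
    \<comment> \<open>Build up \<open>x\<close> by truncations; each new coordinate costs a power of
      one unit vector.\<close>
    have "(\<lambda>i\<in>{1..d}. if i \<le> k then x i else 0) \<in> generate (cyclic_product q d) (unit_vector q d ` {1..d})"
      if "k \<le> d" for k
      using that
    proof (induction k)
      case 0
      have "(\<lambda>i\<in>{1..d}. if i \<le> 0 then x i else 0) = \<one>\<^bsub>cyclic_product q d\<^esub>"
        by (auto simp: fun_eq_iff)
      then show ?case by (simp only: W.one_closed)
    next
      case (Suc k)
      let ?v = "unit_vector q d (Suc k) [^]\<^bsub>cyclic_product q d\<^esub> nat (x (Suc k))"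
      have "unit_vector q d (Suc k) \<in> generate (cyclic_product q d) (unit_vector q d ` {1..d})"
        using Suc.prems by (intro generate.incl) auto
      then have v: "?v \<in> generate (cyclic_product q d) (unit_vector q d ` {1..d})"
        using A.subgroup_int_pow_closed[OF W.subgroup_axioms, of _ "int (nat (x (Suc k)))"]
        unfolding int_pow_int by blast
      have eq: "(\<lambda>i\<in>{1..d}. if i \<le> Suc k then x i else 0) =
          (\<lambda>i\<in>{1..d}. if i \<le> k then x i else 0) \<otimes>\<^bsub>cyclic_product q d\<^esub> ?v"
        unfolding pow_unit_vector using xi Suc.prems by (auto simp: fun_eq_iff le_Suc_eq)
      have "k \<le> d" using Suc.prems by simp
      then show ?case unfolding eq by (rule W.m_closed[OF Suc.IH v])
    qed
    from this[of d] have "(\<lambda>i\<in>{1..d}. if i \<le> d then x i else 0) \<in> generate (cyclic_product q d) (unit_vector q d ` {1..d})"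
      by simp
    also have "(\<lambda>i\<in>{1..d}. if i \<le> d then x i else 0) = x"
      using x by (auto simp: fun_eq_iff PiE_iff extensional_def)
    finally show ?thesis .
  qed
  then show ?thesis using W.subset by blast
qed

lemma cyclic_product_extension:
  assumes q: "\<And>i. q i > 0"
  shows "cyclic_central_extension (cyclic_product q (Suc d)) (cyclic_product q d)
    (\<lambda>x. restrict x {1..d}) (unit_vector q (Suc d) (Suc d)) (q (Suc d))"
proof -
  let ?G = "cyclic_product q (Suc d)" and ?c = "unit_vector q (Suc d) (Suc d)"
  interpret G: group ?G by (rule group_cyclic_product)
  have c: "?c \<in> carrier ?G" by (rule unit_vector_carrier[OF q])
  show ?thesis
  proof (intro cyclic_central_extension.intro cyclic_central_extension_axioms.intro)
    show "(\<lambda>x. restrict x {1..d}) \<in> hom ?G (cyclic_product q d)"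
      by (rule homI) (auto simp: fun_eq_iff)
    show "(\<lambda>x. restrict x {1..d}) ` carrier ?G = carrier (cyclic_product q d)"
    proof (intro equalityI subsetI)
      fix y assume y: "y \<in> carrier (cyclic_product q d)"
      have "y = restrict (\<lambda>i\<in>{1..Suc d}. if i = Suc d then 0 else y i) {1..d}"
        using y by (auto simp: fun_eq_iff PiE_iff extensional_def)
      moreover have "(\<lambda>i\<in>{1..Suc d}. if i = Suc d then 0 else y i) \<in> carrier ?G"
        using y by auto
      ultimately show "y \<in> (\<lambda>x. restrict x {1..d}) ` carrier ?G" by (rule image_eqI)
    qed auto
    show "x \<otimes>\<^bsub>?G\<^esub> ?c = ?c \<otimes>\<^bsub>?G\<^esub> x" for x
      by (simp add: add.commute)
    show "G.ord ?c = q (Suc d)"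
    proof (subst G.ord_unique[OF c], intro allI)
      fix n :: nat
      have "?c [^]\<^bsub>?G\<^esub> n = \<one>\<^bsub>?G\<^esub> \<longleftrightarrow> int n mod int (q (Suc d)) = 0"
        unfolding pow_unit_vector by (auto simp: fun_eq_iff)
      then show "?c [^]\<^bsub>?G\<^esub> n = \<one>\<^bsub>?G\<^esub> \<longleftrightarrow> q (Suc d) dvd n"
        by (simp add: mod_eq_0_iff_dvd)
    qed
    show "restrict x {1..d} = \<one>\<^bsub>cyclic_product q d\<^esub> \<longleftrightarrow> (\<exists>i<q (Suc d). x = ?c [^]\<^bsub>?G\<^esub> i)"
      if x: "x \<in> carrier ?G" for x
    proof
      have xd: "0 \<le> x (Suc d)" "x (Suc d) < int (q (Suc d))"
        using PiE_mem[OF x[unfolded carrier_product_group], of "Suc d"] q[of "Suc d"]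
        by (simp_all add: carrier_integer_mod_group)
      assume r: "restrict x {1..d} = \<one>\<^bsub>cyclic_product q d\<^esub>"
      have x0: "x i = 0" if "i \<in> {1..d}" for i
        using fun_cong[OF r, of i] that by simp
      have "x = ?c [^]\<^bsub>?G\<^esub> nat (x (Suc d))"
        unfolding pow_unit_vector
      proof (rule ext)
        fix i
        consider "i = Suc d" | "i \<in> {1..d}" | "i \<notin> {1..Suc d}" by fastforce
        then show "x i = (\<lambda>i\<in>{1..Suc d}. if i = Suc d then int (nat (x (Suc d))) mod int (q i) else 0) i"
          using xd x0 x by cases (auto simp: PiE_iff extensional_def)
      qed
      moreover have "nat (x (Suc d)) < q (Suc d)" using xd by simp
      ultimately show "\<exists>i<q (Suc d). x = ?c [^]\<^bsub>?G\<^esub> i" by blast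
    next
      assume "\<exists>i<q (Suc d). x = ?c [^]\<^bsub>?G\<^esub> i"
      then show "restrict x {1..d} = \<one>\<^bsub>cyclic_product q d\<^esub>"
        unfolding pow_unit_vector by (auto simp: fun_eq_iff)
    qed
  qed (use c q in \<open>simp_all del: carrier_product_group\<close>)
qed

text \<open>When the factor of order \<open>q (Suc d)\<close> is split off, the pairing with its
  generator is determined by the \<open>d\<close> other unit vectors, which explains the exponent
  \<open>i - 1\<close>.\<close>

lemma schur_multiplier_cyclic_product:
  assumes q: "\<And>i. q i > 0"
  shows "finite (carrier (schur_multiplier (cyclic_product q d)))"
    "order (schur_multiplier (cyclic_product q d)) \<le> (\<Prod>i=1..d. q i ^ (i - 1))"
proof (induction d)
  case 0
  have "carrier (cyclic_product q 0) = {\<one>\<^bsub>cyclic_product q 0\<^esub>}"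
    by (simp add: fun_eq_iff)
  note triv = schur_multiplier_trivial_group[OF group_cyclic_product this]
  {
    case 1 show ?case by (rule triv(1))
  next
    case 2 show ?case using triv(2) by simp
  }
next
  case (Suc d)
  interpret E: cyclic_central_extension "cyclic_product q (Suc d)" "cyclic_product q d"
    "\<lambda>x. restrict x {1..d}" "unit_vector q (Suc d) (Suc d)" "q (Suc d)"
    by (rule cyclic_product_extension[OF q])
  let ?G = "cyclic_product q (Suc d)"
  let ?T = "unit_vector q (Suc d) ` {1..d}"
  have T: "?T \<subseteq> carrier ?G" using unit_vector_carrier[of q "Suc d"] q by blast
  have "insert (unit_vector q (Suc d) (Suc d)) ?T = unit_vector q (Suc d) ` {1..Suc d}"
    by (auto simp: atLeastAtMostSuc_conv)
  then have gen: "generate ?G (insert (unit_vector q (Suc d) (Suc d)) ?T) = carrier ?G"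
    using generate_unit_vectors[of q "Suc d"] q by simp
  \<comment> \<open>Only an inequality, because the unit vectors of trivial factors
    coincide.\<close>
  have card: "card ?T \<le> d" using card_image_le[of "{1..d}" "unit_vector q (Suc d)"] by simp
  note bound = E.schur_multiplier_bound[OF T _ E.symmetric_on_generators[OF _ T gen] Suc.IH(1) refl]
  {
    case 1 show ?case by (rule bound(1)) auto
  next
    case 2
    let ?m' = "if unit_vector q (Suc d) (Suc d) \<in> derived ?G (carrier ?G) then q (Suc d) else 1"
    have "1 \<le> ?m'" using q[of "Suc d"] by simp
    then have "order (schur_multiplier ?G) * 1 \<le> order (schur_multiplier ?G) * ?m'"
      by (rule mult_le_mono2)
    also have "\<dots> \<le> order (schur_multiplier (cyclic_product q d)) * q (Suc d) ^ card ?T"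
      by (rule bound(2)) auto
    also have "\<dots> \<le> (\<Prod>i=1..d. q i ^ (i - 1)) * q (Suc d) ^ d"
      using Suc.IH(2) q[of "Suc d"] card by (intro mult_le_mono power_increasing) auto
    finally show ?case by (simp add: mult.commute)
  }
qed

section \<open>Groups with a commutator subgroup of prime order\<close>

text \<open>The inverse-free relations say that conjugation by \<open>w\<close> maps \<open>u\<close> to \<open>u \<otimes> a\<close> and \<open>v\<close> to
  \<open>v \<otimes> b\<close>; such a conjugation fixes the commutator \<open>k\<close> of \<open>u\<close> and \<open>v\<close>.\<close>

lemma (in group) commutes_with_commutator:
  assumes cl: "u \<in> carrier G" "v \<in> carrier G" "w \<in> carrier G" "a \<in> carrier G" "b \<in> carrier G" "k \<in> carrier G"
    and k: "u \<otimes> v = k \<otimes> (v \<otimes> u)"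
    and w: "w \<otimes> u = u \<otimes> a \<otimes> w" "w \<otimes> v = v \<otimes> b \<otimes> w"
    and com: "a \<otimes> u = u \<otimes> a" "a \<otimes> v = v \<otimes> a" "b \<otimes> u = u \<otimes> b" "b \<otimes> v = v \<otimes> b" "a \<otimes> b = b \<otimes> a"
  shows "w \<otimes> k = k \<otimes> w"
proof -
  have 1: "w \<otimes> (u \<otimes> v) = (u \<otimes> v) \<otimes> (a \<otimes> b) \<otimes> w"
  proof -
    have "w \<otimes> (u \<otimes> v) = (w \<otimes> u) \<otimes> v" using cl by (simp add: m_assoc)
    also have "\<dots> = u \<otimes> a \<otimes> (w \<otimes> v)" unfolding w(1) using cl by (simp add: m_assoc)
    also have "\<dots> = u \<otimes> (a \<otimes> v) \<otimes> b \<otimes> w" unfolding w(2) using cl by (simp add: m_assoc)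
    also have "\<dots> = (u \<otimes> v) \<otimes> (a \<otimes> b) \<otimes> w" unfolding com(2) using cl by (simp add: m_assoc)
    finally show ?thesis .
  qed
  have 2: "w \<otimes> (v \<otimes> u) = (v \<otimes> u) \<otimes> (a \<otimes> b) \<otimes> w"
  proof -
    have "w \<otimes> (v \<otimes> u) = (w \<otimes> v) \<otimes> u" using cl by (simp add: m_assoc)
    also have "\<dots> = v \<otimes> b \<otimes> (w \<otimes> u)" unfolding w(2) using cl by (simp add: m_assoc)
    also have "\<dots> = v \<otimes> (b \<otimes> u) \<otimes> a \<otimes> w" unfolding w(1) using cl by (simp add: m_assoc)
    also have "\<dots> = (v \<otimes> u) \<otimes> (a \<otimes> b) \<otimes> w" unfolding com(3,5) using cl by (simp add: m_assoc)
    finally show ?thesis .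
  qed
  \<comment> \<open>Moving \<open>w\<close> past \<open>u \<otimes> v\<close> and past
    \<open>v \<otimes> u\<close> produces the same factor \<open>a \<otimes> b\<close>, so it
    cancels from the commutator.\<close>
  have "(w \<otimes> k) \<otimes> (v \<otimes> u) = w \<otimes> (k \<otimes> (v \<otimes> u))" using cl by (simp add: m_assoc)
  also have "\<dots> = (u \<otimes> v) \<otimes> (a \<otimes> b) \<otimes> w" unfolding k[symmetric] by (rule 1)
  also have "\<dots> = k \<otimes> ((v \<otimes> u) \<otimes> (a \<otimes> b) \<otimes> w)" unfolding k using cl by (simp add: m_assoc)
  also have "\<dots> = k \<otimes> (w \<otimes> (v \<otimes> u))" unfolding 2 ..
  also have "\<dots> = (k \<otimes> w) \<otimes> (v \<otimes> u)" using cl by (simp add: m_assoc)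
  finally show ?thesis using cl by simp
qed

text \<open>The central extension by the nonzero complex numbers. The second component of its
  identity compensates for \<open>f\<close> not being normalised.\<close>

definition cocycle_extension :: "('a, 'b) monoid_scheme \<Rightarrow> ('a \<times> 'a \<Rightarrow> complex) \<Rightarrow> ('a \<times> complex) monoid" where
  "cocycle_extension G f = \<lparr>carrier = carrier G \<times> - {0},
    monoid.mult = (\<lambda>(x, s) (y, t). (x \<otimes>\<^bsub>G\<^esub> y, s * t * f (x, y))),
    one = (\<one>\<^bsub>G\<^esub>, inverse (f (\<one>\<^bsub>G\<^esub>, \<one>\<^bsub>G\<^esub>)))\<rparr>"

lemma (in group) group_cocycle_extension:
  assumes f: "f \<in> cocycles2 G"
  shows "group (cocycle_extension G f)"
proof (rule groupI)
  note nz = cocycle_nonzero[OF f]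
  show "\<one>\<^bsub>cocycle_extension G f\<^esub> \<in> carrier (cocycle_extension G f)"
    using nz[of \<one> \<one>] by (simp add: cocycle_extension_def)
  fix a assume a: "a \<in> carrier (cocycle_extension G f)"
  obtain x s where x: "a = (x, s)" "x \<in> carrier G" "s \<noteq> 0"
    using a by (auto simp: cocycle_extension_def)
  show "\<one>\<^bsub>cocycle_extension G f\<^esub> \<otimes>\<^bsub>cocycle_extension G f\<^esub> a = a"
    using x cocycle_one(1)[OF f x(2)] nz[of \<one> \<one>] by (simp add: cocycle_extension_def)
  show "\<exists>b\<in>carrier (cocycle_extension G f). b \<otimes>\<^bsub>cocycle_extension G f\<^esub> a = \<one>\<^bsub>cocycle_extension G f\<^esub>"
    \<comment> \<open>The second component solves t * s * \<open>f (inv x, x)\<close> =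
      \<open>inverse (f (\<one>, \<one>))\<close> for t.\<close>
    by (rule bexI[of _ "(inv x, inverse (f (\<one>, \<one>)) / (s * f (inv x, x)))"])
      (use x nz[of \<one> \<one>] nz[of "inv x" x] in \<open>simp_all add: cocycle_extension_def\<close>)
  fix b assume b: "b \<in> carrier (cocycle_extension G f)"
  obtain y t where y: "b = (y, t)" "y \<in> carrier G" "t \<noteq> 0"
    using b by (auto simp: cocycle_extension_def)
  show "a \<otimes>\<^bsub>cocycle_extension G f\<^esub> b \<in> carrier (cocycle_extension G f)"
    using x y nz[of x y] by (simp add: cocycle_extension_def)
  fix c assume c: "c \<in> carrier (cocycle_extension G f)"
  obtain z r where z: "c = (z, r)" "z \<in> carrier G" "r \<noteq> 0"
    using c by (auto simp: cocycle_extension_def)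
  show "a \<otimes>\<^bsub>cocycle_extension G f\<^esub> b \<otimes>\<^bsub>cocycle_extension G f\<^esub> c =
      a \<otimes>\<^bsub>cocycle_extension G f\<^esub> (b \<otimes>\<^bsub>cocycle_extension G f\<^esub> c)"
    using cocycle_eq[OF f x(2) y(2) z(2)] x y z
    by (simp add: cocycle_extension_def m_assoc mult_ac)
qed

lemma (in group) cocycle_extension_commutes_iff:
  assumes f: "f \<in> cocycles2 G" and "x \<in> carrier G" "y \<in> carrier G" "s \<noteq> 0" "t \<noteq> 0"
    and "x \<otimes> y = y \<otimes> x"
  shows "(x, s) \<otimes>\<^bsub>cocycle_extension G f\<^esub> (y, t) = (y, t) \<otimes>\<^bsub>cocycle_extension G f\<^esub> (x, s) \<longleftrightarrow>
    f (x, y) = f (y, x)"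
  using assms by (simp add: cocycle_extension_def)

text \<open>As \<open>H\<close> is commutative, conjugation changes lifts only by elements over the
  kernel, and these commute with the lifts of \<open>u\<close> and \<open>v\<close> by
  \<open>sym\<close>. The commutator of the lifts lies over a nontrivial power of \<open>c\<close>,
  with which \<open>x\<close> then pairs trivially. Primality of \<open>m\<close> passes from this
  power to \<open>c\<close> itself.\<close>

lemma (in cyclic_central_extension) symmetric_on_noncommuting_pair:
  assumes prime: "Factorial_Ring.prime m" and H: "comm_group H" and f: "f \<in> cocycles2 G"
    and u: "u \<in> carrier G" and v: "v \<in> carrier G" and nc: "u \<otimes> v \<noteq> v \<otimes> u"
    and sym: "f (u, c) = f (c, u)" "f (v, c) = f (c, v)" and x: "x \<in> carrier G"
  shows "f (x, c) = f (c, x)"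
proof -
  let ?E = "cocycle_extension G f"
  interpret A: comm_group H by fact
  interpret E: group ?E by (rule G.group_cocycle_extension[OF f])
  have fst_mult: "fst (a \<otimes>\<^bsub>?E\<^esub> b) = fst a \<otimes> fst b" for a b
    by (simp add: cocycle_extension_def split_beta)
  have E_iff: "a \<in> carrier ?E \<longleftrightarrow> fst a \<in> carrier G \<and> snd a \<noteq> 0" for a
    by (simp add: cocycle_extension_def mem_Times_iff)
  have fst_inv: "fst (inv\<^bsub>?E\<^esub> a) = inv (fst a)" if "a \<in> carrier ?E" for a
  proof (rule G.inv_equality[symmetric])
    have "fst (inv\<^bsub>?E\<^esub> a \<otimes>\<^bsub>?E\<^esub> a) = \<one>" using that by (simp only: E.l_inv) (simp add: cocycle_extension_def)
    then show "fst (inv\<^bsub>?E\<^esub> a) \<otimes> fst a = \<one>" by (simp only: fst_mult)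
  qed (use that E.inv_closed[OF that] in \<open>simp_all add: E_iff\<close>)
  have c_com: "c [^] i \<otimes> y = y \<otimes> c [^] i" if "y \<in> carrier G" for y and i :: nat
    using G.group_commutes_pow[OF central[OF that, symmetric] c that] .
  have sym_pow: "f (c [^] i, y) = f (y, c [^] i)" if y: "y \<in> carrier G" and "f (y, c) = f (c, y)" for y and i :: nat
  proof -
    have "f (y, c [^] i) / f (c [^] i, y) = 1"
      using G.commutator_pairing_pow_right[OF f y c central[OF y], of i] that cocycle_nonzero[OF f c y] by simp
    then show ?thesis using cocycle_nonzero[OF f _ y, of "c [^] i"] by simp
  qed
  have over_kernel: "\<exists>i. fst a = c [^] (i::nat)" if "a \<in> carrier ?E" "\<pi> (fst a) = \<one>\<^bsub>H\<^esub>" for a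
    using kernel[of "fst a"] that by (auto simp: E_iff)
  \<comment> \<open>An element over a power of \<open>c\<close> commutes with \<open>b\<close> once
    the first component of \<open>b\<close> pairs trivially with \<open>c\<close>.\<close>
  have kernel_com: "a \<otimes>\<^bsub>?E\<^esub> b = b \<otimes>\<^bsub>?E\<^esub> a"
    if a: "a \<in> carrier ?E" "\<pi> (fst a) = \<one>\<^bsub>H\<^esub>" and b: "b \<in> carrier ?E" and bc: "f (fst b, c) = f (c, fst b)" for a b
  proof -
    obtain i where i: "fst a = c [^] (i::nat)" using over_kernel[OF a] by blast
    have fb: "fst b \<in> carrier G" and nz: "snd a \<noteq> 0" "snd b \<noteq> 0" using a b by (simp_all add: E_iff)
    have ab: "a = (c [^] i, snd a)" "b = (fst b, snd b)" by (simp_all flip: i)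
    show ?thesis
      by (subst (1 2) ab(1), subst (1 2) ab(2),
          rule iffD2[OF G.cocycle_extension_commutes_iff[OF f _ fb nz c_com[OF fb]] sym_pow[OF fb bc]]) simp
  qed
  \<comment> \<open>The pairing of \<open>c\<close> with itself is trivial, so the part of the
    extension over the kernel is commutative.\<close>
  have kernel_sym: "f (fst a, c) = f (c, fst a)" if a: "a \<in> carrier ?E" "\<pi> (fst a) = \<one>\<^bsub>H\<^esub>" for a
    using over_kernel[OF a] sym_pow[OF c refl] by auto
  define U V w where "U = (u, 1::complex)" and "V = (v, 1::complex)" and "w = (x, 1::complex)"
  have cl: "U \<in> carrier ?E" "V \<in> carrier ?E" "w \<in> carrier ?E"
    using u v x by (simp_all add: E_iff U_def V_def w_def)
  define a where "a = inv\<^bsub>?E\<^esub> U \<otimes>\<^bsub>?E\<^esub> (w \<otimes>\<^bsub>?E\<^esub> U \<otimes>\<^bsub>?E\<^esub> inv\<^bsub>?E\<^esub> w)"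
  define b where "b = inv\<^bsub>?E\<^esub> V \<otimes>\<^bsub>?E\<^esub> (w \<otimes>\<^bsub>?E\<^esub> V \<otimes>\<^bsub>?E\<^esub> inv\<^bsub>?E\<^esub> w)"
  define k where "k = U \<otimes>\<^bsub>?E\<^esub> V \<otimes>\<^bsub>?E\<^esub> inv\<^bsub>?E\<^esub> (V \<otimes>\<^bsub>?E\<^esub> U)"
  have abk: "a \<in> carrier ?E" "b \<in> carrier ?E" "k \<in> carrier ?E"
    unfolding a_def b_def k_def using cl by simp_all
  have conj: "\<pi> (inv y \<otimes> (x \<otimes> y \<otimes> inv x)) = \<one>\<^bsub>H\<^esub>" if "y \<in> carrier G" for y
    using that x by (simp add: A.m_comm[of "\<pi> x" "\<pi> y"] H.m_assoc)
  have ker: "\<pi> (fst a) = \<one>\<^bsub>H\<^esub>" "\<pi> (fst b) = \<one>\<^bsub>H\<^esub>"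
    unfolding a_def b_def fst_mult using conj[OF u] conj[OF v] cl
    by (simp_all only: fst_inv) (simp_all add: U_def V_def w_def)
  have fst_k: "fst k = u \<otimes> v \<otimes> inv (v \<otimes> u)"
    unfolding k_def fst_mult using cl by (simp only: fst_inv E.m_closed fst_mult) (simp add: U_def V_def)
  have "\<pi> (fst k) = \<one>\<^bsub>H\<^esub>"
    unfolding fst_k using u v by (simp add: A.m_comm[of "\<pi> u" "\<pi> v"])
  then obtain i where i: "i < m" "fst k = c [^] i" using kernel[of "fst k"] abk by (auto simp: E_iff)
  have "i \<noteq> 0"
  proof
    assume "i = 0"
    then have "u \<otimes> v \<otimes> inv (v \<otimes> u) = \<one>" using i fst_k by simp
    then have "u \<otimes> v = v \<otimes> u" using u v G.inv_solve_right'[of \<one> "u \<otimes> v" "v \<otimes> u"] by simp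
    then show False using nc by simp
  qed
  have "w \<otimes>\<^bsub>?E\<^esub> k = k \<otimes>\<^bsub>?E\<^esub> w"
  proof (rule E.commutes_with_commutator[OF cl abk])
    show "U \<otimes>\<^bsub>?E\<^esub> V = k \<otimes>\<^bsub>?E\<^esub> (V \<otimes>\<^bsub>?E\<^esub> U)"
      unfolding k_def using cl by (simp add: E.m_assoc)
    have r: "w \<otimes>\<^bsub>?E\<^esub> y = y \<otimes>\<^bsub>?E\<^esub> (inv\<^bsub>?E\<^esub> y \<otimes>\<^bsub>?E\<^esub> (w \<otimes>\<^bsub>?E\<^esub> y \<otimes>\<^bsub>?E\<^esub> inv\<^bsub>?E\<^esub> w)) \<otimes>\<^bsub>?E\<^esub> w"
      if y: "y \<in> carrier ?E" for y
    proof -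
      have "y \<otimes>\<^bsub>?E\<^esub> (inv\<^bsub>?E\<^esub> y \<otimes>\<^bsub>?E\<^esub> (w \<otimes>\<^bsub>?E\<^esub> y \<otimes>\<^bsub>?E\<^esub> inv\<^bsub>?E\<^esub> w)) \<otimes>\<^bsub>?E\<^esub> w =
          (y \<otimes>\<^bsub>?E\<^esub> inv\<^bsub>?E\<^esub> y) \<otimes>\<^bsub>?E\<^esub> (w \<otimes>\<^bsub>?E\<^esub> y) \<otimes>\<^bsub>?E\<^esub> (inv\<^bsub>?E\<^esub> w \<otimes>\<^bsub>?E\<^esub> w)"
        using y cl(3) by (simp only: E.m_assoc E.m_closed E.inv_closed)
      then show ?thesis using y cl(3) by simp
    qed
    show "w \<otimes>\<^bsub>?E\<^esub> U = U \<otimes>\<^bsub>?E\<^esub> a \<otimes>\<^bsub>?E\<^esub> w" "w \<otimes>\<^bsub>?E\<^esub> V = V \<otimes>\<^bsub>?E\<^esub> b \<otimes>\<^bsub>?E\<^esub> w"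
      unfolding a_def b_def by (rule r[OF cl(1)] r[OF cl(2)])+
    show "a \<otimes>\<^bsub>?E\<^esub> U = U \<otimes>\<^bsub>?E\<^esub> a" "b \<otimes>\<^bsub>?E\<^esub> U = U \<otimes>\<^bsub>?E\<^esub> b"
      using kernel_com[OF abk(1) ker(1) cl(1)] kernel_com[OF abk(2) ker(2) cl(1)] sym(1) by (simp_all add: U_def)
    show "a \<otimes>\<^bsub>?E\<^esub> V = V \<otimes>\<^bsub>?E\<^esub> a" "b \<otimes>\<^bsub>?E\<^esub> V = V \<otimes>\<^bsub>?E\<^esub> b"
      using kernel_com[OF abk(1) ker(1) cl(2)] kernel_com[OF abk(2) ker(2) cl(2)] sym(2) by (simp_all add: V_def)
    show "a \<otimes>\<^bsub>?E\<^esub> b = b \<otimes>\<^bsub>?E\<^esub> a"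
      by (rule kernel_com[OF abk(1) ker(1) abk(2) kernel_sym[OF abk(2) ker(2)]])
  qed
  moreover have "k = (c [^] i, snd k)" "snd k \<noteq> 0" using abk(3) by (simp_all add: E_iff flip: i(2))
  ultimately have "f (x, c [^] i) = f (c [^] i, x)"
    using G.cocycle_extension_commutes_iff[OF f x _ _ _ c_com[OF x, symmetric], where s = 1 and t = "snd k"]
    unfolding w_def by (metis G.nat_pow_closed c zero_neq_one)
  then have "f (x, c [^] i) / f (c [^] i, x) = 1" using cocycle_nonzero[OF f _ x, of "c [^] i"] by simp
  then have pow_i: "(f (x, c) / f (c, x)) ^ i = 1"
    using G.commutator_pairing_pow_right[OF f x c central[OF x], of i] by simp
  have "f (x, \<one>) / f (\<one>, x) = (f (x, c) / f (c, x)) ^ m"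
    using G.commutator_pairing_pow_right[OF f x c central[OF x], of m] by simp
  then have pow_m: "(f (x, c) / f (c, x)) ^ m = 1"
    using G.cocycle_one[OF f x] cocycle_nonzero[OF f, of \<one> \<one>] by simp
  \<comment> \<open>The pairing value is killed by both exponents \<open>i\<close> and
    \<open>m\<close>; a Bezout relation shows that it is 1.\<close>
  have "coprime i m"
    using prime i(1) \<open>i \<noteq> 0\<close> by (metis coprime_commute nat_dvd_not_less neq0_conv prime_imp_coprime)
  then obtain q r where "i * q = m * r + 1" using bezout_nat[OF \<open>i \<noteq> 0\<close>, of m] by (metis coprime_imp_gcd_eq_1)
  then have "((f (x, c) / f (c, x)) ^ i) ^ q = ((f (x, c) / f (c, x)) ^ m) ^ r * (f (x, c) / f (c, x))"
    by (metis power_add power_mult power_one_right)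
  then have "f (x, c) / f (c, x) = 1" unfolding pow_i pow_m by simp
  then show ?thesis using cocycle_nonzero[OF f c x] by simp
qed

section \<open>Reduction along the commutator subgroup\<close>

text \<open>The conjugacy classes of noncentral elements have order divisible by \<open>p\<close>, so the number of
  central elements in \<open>N\<close> is a multiple of \<open>p\<close>.\<close>

lemma (in group) p_group_normal_central_element:
  assumes p: "Factorial_Ring.prime p" and fin: "finite (carrier G)" and ord: "order G = p ^ n"
    and N: "N \<lhd> G" "card N \<noteq> 1"
  obtains c where "c \<in> N" "\<And>x. x \<in> carrier G \<Longrightarrow> x \<otimes> c = c \<otimes> x" "ord c = p"
proof -
  interpret N: normal N G by fact
  define \<phi> where "\<phi> = (\<lambda>g. \<lambda>h\<in>carrier G. g \<otimes> h \<otimes> inv g)"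
  interpret \<phi>: group_action G "carrier G" \<phi>
    unfolding \<phi>_def by (rule action_by_conjugation)
  define F where "F = {x \<in> N. \<forall>y\<in>carrier G. y \<otimes> x = x \<otimes> y}"
  have finN: "finite N" using fin N.subset by (rule finite_subset[rotated])
  have orbit_sub: "orbit G \<phi> x \<subseteq> N - F" if x: "x \<in> N - F" for x
  proof
    fix y assume y: "y \<in> orbit G \<phi> x"
    then obtain g where g: "g \<in> carrier G" "y = g \<otimes> x \<otimes> inv g"
      using x N.subset by (auto simp: orbit_def \<phi>_def)
    have yN: "y \<in> N" using N.inv_op_closed2[OF g(1)] x g by auto
    have xG: "x \<in> carrier G" using x N.subset by blast
    have "y \<notin> F"
    proof
      assume "y \<in> F"
      then have "g \<otimes> y = y \<otimes> g" using g by (auto simp: F_def)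
      then have "g \<otimes> y = g \<otimes> x" unfolding g(2) using g(1) xG by (simp add: m_assoc)
      then have "y = x" using g(1) xG yN N.subset by auto
      then show False using \<open>y \<in> F\<close> x by blast
    qed
    then show "y \<in> N - F" using yN by blast
  qed
  have orbit_dvd: "p dvd card (orbit G \<phi> x)" if x: "x \<in> N - F" for x
  proof (rule ccontr)
    have xG: "x \<in> carrier G" using x N.subset by blast
    assume nd: "\<not> p dvd card (orbit G \<phi> x)"
    have "card (orbit G \<phi> x) dvd p ^ n"
      using \<phi>.orbit_stabilizer_theorem[OF xG] ord by (metis dvd_triv_left)
    then obtain i where "card (orbit G \<phi> x) = p ^ i" using divides_primepow_nat[OF p] by blast
    \<comment> \<open>Orbit sizes divide a power of \<open>p\<close>, so one not divisible by
      \<open>p\<close> is 1, making \<open>x\<close> central.\<close>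
    then have "card (orbit G \<phi> x) = 1" using nd by (cases i) auto
    then obtain z where z: "orbit G \<phi> x = {z}" by (rule card_1_singletonE)
    have "y \<otimes> x = x \<otimes> y" if y: "y \<in> carrier G" for y
    proof -
      have "\<phi> y x \<in> orbit G \<phi> x" using y by (auto simp: orbit_def)
      then have "y \<otimes> x \<otimes> inv y = x"
        using z \<phi>.orbit_refl[OF xG] xG by (simp add: \<phi>_def)
      then show ?thesis using y xG inv_solve_right'[of x "y \<otimes> x" y] by simp
    qed
    then show False using x by (auto simp: F_def)
  qed
  have "p dvd card (N - F)"
  proof -
    have "(\<Union>x\<in>N - F. orbit G \<phi> x) = N - F"
      using orbit_sub \<phi>.orbit_refl N.subset by blast
    moreover have "p dvd card (\<Union>(orbit G \<phi> ` (N - F)))"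
    proof (rule dvd_partition)
      show "finite (\<Union>(orbit G \<phi> ` (N - F)))"
        using calculation finN by simp
      show "\<forall>c\<in>orbit G \<phi> ` (N - F). p dvd card c" using orbit_dvd by blast
      show "\<forall>c1\<in>orbit G \<phi> ` (N - F). \<forall>c2\<in>orbit G \<phi> ` (N - F). c1 \<noteq> c2 \<longrightarrow> c1 \<inter> c2 = {}"
      proof (intro ballI impI, rule ccontr)
        fix c1 c2 assume c: "c1 \<in> orbit G \<phi> ` (N - F)" "c2 \<in> orbit G \<phi> ` (N - F)" "c1 \<noteq> c2"
          and "c1 \<inter> c2 \<noteq> {}"
        then obtain z where z: "z \<in> c1" "z \<in> c2" by blast
        have "c1 \<in> orbits G (carrier G) \<phi>" "c2 \<in> orbits G (carrier G) \<phi>"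
          using c N.subset by (auto simp: orbits_def)
        moreover have "z \<in> carrier G" using z c orbit_sub N.subset by blast
        ultimately show False
          using \<phi>.orbit_partition z c(3) unfolding partition_def by blast
      qed
    qed
    ultimately show ?thesis by simp
  qed
  moreover have "p dvd card N"
  proof -
    have "card N dvd p ^ n" using lagrange[OF N.subgroup_axioms] ord by (metis dvd_triv_right)
    then obtain i where "card N = p ^ i" using divides_primepow_nat[OF p] by blast
    then show ?thesis using N(2) by (cases i) auto
  qed
  moreover have FN: "F \<subseteq> N" by (auto simp: F_def)
  moreover have "card N = card F + card (N - F)"
    using card_Diff_subset[OF finite_subset[OF FN finN] FN] card_mono[OF finN FN] by simp
  ultimately have "p dvd card F" by (simp add: dvd_add_left_iff)
  moreover have oneF: "\<one> \<in> F" by (auto simp: F_def)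
  \<comment> \<open>The identity makes the count positive; being a multiple of \<open>p\<close>, it
    exceeds 1.\<close>
  ultimately have "p \<le> card F"
    using finite_subset[OF FN finN] by (metis card_gt_0_iff dvd_imp_le emptyE)
  then have "F \<noteq> {\<one>}" using prime_gt_1_nat[OF p] by auto
  then obtain x where x: "x \<in> F" "x \<noteq> \<one>" using oneF by blast
  then have xG: "x \<in> carrier G" using FN N.subset by blast
  have "ord x dvd p ^ n" using ord_dvd_group_order[OF xG] ord by simp
  then obtain i where i: "ord x = p ^ i" using divides_primepow_nat[OF p] by blast
  have "i \<noteq> 0" using i x ord_eq_1[OF xG] by (metis power_0)
  \<comment> \<open>The power of \<open>x\<close> with exponent \<open>p ^ (i - 1)\<close> stays
    central and in \<open>N\<close>, and its order drops to exactly \<open>p\<close>.\<close>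
  then have i_split: "p ^ i = p ^ (i - 1) * p" by (metis power_minus_mult neq0_conv)
  show thesis
  proof
    show "x [^] p ^ (i - 1) \<in> N"
      using subgroup_int_pow_closed[OF N.subgroup_axioms, of x "int (p ^ (i - 1))"] x FN
      unfolding int_pow_int by blast
    show "y \<otimes> x [^] p ^ (i - 1) = x [^] p ^ (i - 1) \<otimes> y" if "y \<in> carrier G" for y
      using group_commutes_pow[of x y "p ^ (i - 1)"] x that xG by (simp add: F_def)
    show "ord (x [^] p ^ (i - 1)) = p"
    proof (subst ord_unique[OF nat_pow_closed[OF xG]], intro allI)
      fix k :: nat
      have "(x [^] p ^ (i - 1)) [^] k = \<one> \<longleftrightarrow> p ^ (i - 1) * p dvd p ^ (i - 1) * k"
        using xG by (simp add: nat_pow_pow pow_eq_id i i_split)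
      then show "(x [^] p ^ (i - 1)) [^] k = \<one> \<longleftrightarrow> p dvd k"
        using prime_gt_0_nat[OF p] by simp
    qed
  qed
qed

text \<open>The quotient is realised on a set of coset representatives, so that it has the same type
  as \<open>G\<close> and the induction below can be carried out for a fixed type.\<close>

lemma (in group) ex_quotient_by_central:
  assumes c: "c \<in> carrier G" and central: "\<And>x. x \<in> carrier G \<Longrightarrow> x \<otimes> c = c \<otimes> x" and pos: "ord c > 0"
  obtains H :: "('a, 'b) monoid_scheme" and \<pi> where "cyclic_central_extension G H \<pi> c (ord c)"
proof -
  define Z where "Z = generate G {c}"
  have Z_eq: "Z = {c [^] i | i. i \<in> (UNIV :: nat set)}"
    unfolding Z_def using generate_pow_nat[OF c] pos by auto
  have Z: "subgroup Z G" unfolding Z_def using c by (intro generate_is_subgroup) auto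
  interpret Z: subgroup Z G by (rule Z)
  have Z_com: "z \<otimes> x = x \<otimes> z" if "z \<in> Z" "x \<in> carrier G" for z x
    using that group_commutes_pow[OF central[symmetric] c] by (auto simp: Z_eq)
  define r where "r x = (SOME y. y \<in> Z #> x)" for x
  have r_in: "r x \<in> Z #> x" if "x \<in> carrier G" for x
    unfolding r_def using rcos_self[OF that Z] by (rule someI)
  have coset_r: "Z #> r x = Z #> x" if "x \<in> carrier G" for x
    using repr_independence[OF r_in[OF that] that Z] by simp
  have r_carrier: "r x \<in> carrier G" if "x \<in> carrier G" for x
    using r_in[OF that] r_coset_subset_G[OF Z.subset that] by blast
  have r_eq_iff: "r x = r y \<longleftrightarrow> Z #> x = Z #> y" if "x \<in> carrier G" "y \<in> carrier G" for x y
  proof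
    assume "r x = r y"
    then show "Z #> x = Z #> y" using coset_r that by metis
  next
    assume "Z #> x = Z #> y"
    then show "r x = r y" unfolding r_def by (rule arg_cong)
  qed
  have r_mult: "r (x \<otimes> y) = r (r x \<otimes> r y)" if xy: "x \<in> carrier G" "y \<in> carrier G" for x y
  proof -
    obtain a b where ab: "a \<in> Z" "b \<in> Z" "r x = a \<otimes> x" "r y = b \<otimes> y"
      using r_in[OF xy(1)] r_in[OF xy(2)] by (auto simp: r_coset_def)
    have "r x \<otimes> r y = (a \<otimes> b) \<otimes> (x \<otimes> y)"
    proof -
      have "r x \<otimes> r y = a \<otimes> (x \<otimes> b) \<otimes> y" using ab xy by (simp add: m_assoc)
      also have "\<dots> = a \<otimes> (b \<otimes> x) \<otimes> y" unfolding Z_com[OF ab(2) xy(1)] ..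
      finally show ?thesis using ab xy by (simp add: m_assoc)
    qed
    then have "r x \<otimes> r y \<in> Z #> (x \<otimes> y)"
      using ab by (auto simp: r_coset_def)
    then have "Z #> (x \<otimes> y) = Z #> (r x \<otimes> r y)"
      by (rule repr_independence) (use xy Z in auto)
    then show ?thesis using xy r_carrier by (subst r_eq_iff) auto
  qed
  \<comment> \<open>Two stages: \<open>r\<close> is a homomorphism to \<open>H0\<close>, and
    \<open>hom_imp_img_group\<close> makes its image, with unit \<open>r \<one>\<close>, a
    group.\<close>
  define H0 where "H0 = G\<lparr>mult := \<lambda>x y. r (x \<otimes> y)\<rparr>"
  define H where "H = H0\<lparr>carrier := r ` carrier G, one := r \<one>\<rparr>"
  have "r \<in> hom G H0"
    by (rule homI) (simp_all add: H0_def r_carrier r_mult[symmetric])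
  then interpret H: group H unfolding H_def by (rule hom_imp_img_group)
  have "cyclic_central_extension G H r c (ord c)"
  proof (intro cyclic_central_extension.intro cyclic_central_extension_axioms.intro is_group H.is_group)
    show "r \<in> hom G H"
      by (rule homI) (simp_all add: H_def H0_def r_mult[symmetric])
    show "r ` carrier G = carrier H" by (simp add: H_def)
    show "r x = \<one>\<^bsub>H\<^esub> \<longleftrightarrow> (\<exists>i<(ord c). x = c [^] i)" if x: "x \<in> carrier G" for x
    proof -
      have "r x = \<one>\<^bsub>H\<^esub> \<longleftrightarrow> Z #> x = Z #> \<one>"
        using r_eq_iff[OF x one_closed] by (simp add: H_def)
      also have "\<dots> \<longleftrightarrow> x \<in> Z"
        using x Z by (metis Z.rcos_const coset_join1 coset_mult_one is_group Z.subset)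
      also have "\<dots> \<longleftrightarrow> (\<exists>i<(ord c). x = c [^] i)"
      proof
        assume "x \<in> Z"
        then obtain i where i: "x = c [^] (i::nat)" by (auto simp: Z_eq)
        have "c [^] i = (c [^] ord c) [^] (i div ord c) \<otimes> c [^] (i mod ord c)"
          using c by (simp only: nat_pow_pow nat_pow_mult) (simp add: mult.commute)
        then have "x = c [^] (i mod ord c)" using c i by simp
        then show "\<exists>i<(ord c). x = c [^] i" using pos mod_less_divisor by blast
      qed (auto simp: Z_eq)
      finally show ?thesis .
    qed
  qed (use assms in auto)
  then show thesis by (rule that)
qed

text \<open>An invariant set is a union of fibres, each a cycle of \<open>m\<close> distinct
  elements. It is applied both to the whole group and to its commutator subgroup.\<close>

lemma (in cyclic_central_extension) card_invariant_subset:
  assumes D: "D \<subseteq> carrier G" "finite D" and inv: "\<And>x i. x \<in> D \<Longrightarrow> x \<otimes> c [^] (i::nat) \<in> D"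
  shows "card D = m * card (\<pi> ` D)"
proof -
  have fib: "card {y \<in> D. \<pi> y = z} = m" if z: "z \<in> \<pi> ` D" for z
  proof -
    obtain x where x: "x \<in> D" "z = \<pi> x" using z by blast
    have xG: "x \<in> carrier G" using x D by blast
    have "{y \<in> D. \<pi> y = z} = (\<lambda>i. x \<otimes> c [^] i) ` {..<m}"
    proof (intro equalityI subsetI)
      fix y assume "y \<in> {y \<in> D. \<pi> y = z}"
      then have "y \<in> carrier G" "\<pi> x = \<pi> y" using x D by auto
      then show "y \<in> (\<lambda>i. x \<otimes> c [^] i) ` {..<m}" using fiber[OF xG] by blast
    next
      fix y assume "y \<in> (\<lambda>i. x \<otimes> c [^] i) ` {..<m}"
      then show "y \<in> {y \<in> D. \<pi> y = z}" using inv[OF x(1)] x(2) xG by (auto simp: hom_nat_pow)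
    qed
    moreover have "inj_on (\<lambda>i. x \<otimes> c [^] i) {..<m}"
    proof (rule inj_onI)
      fix i j assume "i \<in> {..<m}" "j \<in> {..<m}" "x \<otimes> c [^] i = x \<otimes> c [^] j"
      then show "i = j" using c_pow_inj[of i j] xG by simp
    qed
    ultimately show ?thesis by (simp add: card_image)
  qed
  have "card D = (\<Sum>x\<in>D. 1)" by simp
  also have "\<dots> = (\<Sum>z\<in>\<pi> ` D. \<Sum>y\<in>{y \<in> D. \<pi> y = z}. 1)"
    by (rule sum.image_gen[OF D(2)])
  also have "\<dots> = (\<Sum>z\<in>\<pi> ` D. m)" using fib by (intro sum.cong) auto
  finally show ?thesis by simp
qed

text \<open>Dividing by a subgroup of the commutator subgroup leaves the abelianization unchanged.
  Describing it by a surjection \<open>\<psi>\<close> with the right kernel lets a single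
  \<open>A\<close> serve the whole induction. The bound \<open>card S \<le> d\<close> survives in
  quotients, where images of generators may coincide.\<close>

theorem schur_multiplier_p_group_bound:
  fixes G :: "('a, 'b) monoid_scheme" and A :: "('c, 'd) monoid_scheme"
  assumes p: "Factorial_Ring.prime p" and A: "comm_group A" "finite (carrier (schur_multiplier A))"
    and "group G" "finite (carrier G)" "order G = p ^ n"
    and "\<psi> \<in> hom G A" "\<psi> ` carrier G = carrier A"
    and "\<And>x. x \<in> carrier G \<Longrightarrow> \<psi> x = \<one>\<^bsub>A\<^esub> \<longleftrightarrow> x \<in> derived G (carrier G)"
    and "card (derived G (carrier G)) = p ^ Suc k"
    and "S \<subseteq> carrier G" "finite S" "card S \<le> d" "generate G S = carrier G" and d: "d > 0"
  shows "finite (carrier (schur_multiplier G)) \<and>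
    order (schur_multiplier G) \<le> order (schur_multiplier A) * p ^ ((d - 1) * k + 1)"
  using assms(4-14)
proof (induction k arbitrary: G n \<psi> S)
  case (0 G n \<psi> S)
  interpret G: group G by fact
  interpret A: comm_group A by fact
  have p1: "p > 1" using prime_gt_1_nat[OF p] .
  let ?D = "derived G (carrier G)"
  have D: "?D \<lhd> G" using G.derived_is_normal[OF G.normal_self] .
  have "card ?D \<noteq> 1" using 0 p1 by simp
  with G.p_group_normal_central_element[OF p 0(2,3) D] obtain c where c: "c \<in> ?D"
    "\<And>x. x \<in> carrier G \<Longrightarrow> x \<otimes>\<^bsub>G\<^esub> c = c \<otimes>\<^bsub>G\<^esub> x" "G.ord c = p" by blast
  interpret D: normal ?D G by (rule D)
  have cG: "c \<in> carrier G" using c(1) D.subset by blast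
  have pow_D: "c [^]\<^bsub>G\<^esub> i \<in> ?D" for i :: nat
    using G.subgroup_int_pow_closed[OF D.subgroup_axioms c(1), of "int i"] by (simp add: int_pow_int)
  have inj: "inj_on (\<lambda>i. c [^]\<^bsub>G\<^esub> i) {..<p}"
    using G.ord_inj[OF cG] unfolding c(3) by (rule inj_on_subset) auto
  \<comment> \<open>A commutator subgroup of order \<open>p\<close> consists of the powers of
    \<open>c\<close>, so \<open>\<psi>\<close> itself is a central extension with cyclic
    kernel.\<close>
  have "(\<lambda>i. c [^]\<^bsub>G\<^esub> i) ` {..<p} = ?D"
  proof (rule card_subset_eq)
    show "finite ?D" using 0(2) D.subset by (rule finite_subset[rotated])
  qed (use pow_D inj 0 in \<open>auto simp: card_image\<close>)
  then have D_iff: "x \<in> ?D \<longleftrightarrow> (\<exists>i<p. x = c [^]\<^bsub>G\<^esub> i)" for x by auto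
  interpret E: cyclic_central_extension G A \<psi> c p
    by (intro cyclic_central_extension.intro cyclic_central_extension_axioms.intro G.is_group A.is_group
        0(4,5) cG c(2,3)) (use p1 0(6) D_iff in auto)
  have "\<exists>u\<in>carrier G. \<exists>v\<in>carrier G. u \<otimes>\<^bsub>G\<^esub> v \<noteq> v \<otimes>\<^bsub>G\<^esub> u"
  proof (rule ccontr)
    assume "\<not> ?thesis"
    then have "comm_group G" by (intro G.group_comm_groupI) auto
    then have "?D = {\<one>\<^bsub>G\<^esub>}" by (rule comm_group.derived_eq_singleton) simp
    then show False using \<open>card ?D \<noteq> 1\<close> by simp
  qed
  then obtain u v where uv: "u \<in> carrier G" "v \<in> carrier G" "u \<otimes>\<^bsub>G\<^esub> v \<noteq> v \<otimes>\<^bsub>G\<^esub> u" by blast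
  have gen: "f (x, c) = f (c, x)" if "f \<in> cocycles2 G" "\<And>t. t \<in> {u, v} \<Longrightarrow> f (t, c) = f (c, t)"
    "x \<in> carrier G" for f x
    using E.symmetric_on_noncommuting_pair[OF p A(1) that(1) uv _ _ that(3)] that(2) by simp
  have T: "{u, v} \<subseteq> carrier G" "finite {u, v}" using uv by simp_all
  note bound = E.schur_multiplier_bound[OF T gen A(2) if_P[OF c(1), symmetric]]
  \<comment> \<open>Two test elements cost \<open>p\<close> squared and transgression returns one
    \<open>p\<close>, so the net factor is \<open>p\<close> whatever \<open>d\<close> is.\<close>
  have "order (schur_multiplier G) * p \<le> order (schur_multiplier A) * p ^ card {u, v}"
    by (rule bound(2))
  also have "\<dots> \<le> order (schur_multiplier A) * p ^ 2"
    using p1 by (intro mult_le_mono2 power_increasing) (auto simp: card_insert_if)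
  finally have "order (schur_multiplier G) * p \<le> (order (schur_multiplier A) * p) * p"
    by (simp add: power2_eq_square mult.assoc)
  then have "order (schur_multiplier G) \<le> order (schur_multiplier A) * p"
    using p1 by simp
  moreover have "finite (carrier (schur_multiplier G))" by (rule bound(1))
  ultimately show ?case by simp
next
  case (Suc k G n \<psi> S)
  interpret G: group G by fact
  interpret A: comm_group A by fact
  have p1: "p > 1" using prime_gt_1_nat[OF p] .
  let ?D = "derived G (carrier G)"
  have D: "?D \<lhd> G" using G.derived_is_normal[OF G.normal_self] .
  have "p ^ 1 \<le> p ^ Suc (Suc k)" using p1 by (intro power_increasing) auto
  then have "card ?D \<noteq> 1" using Suc.prems(7) p1 by simp
  with G.p_group_normal_central_element[OF p Suc.prems(2,3) D] obtain c where c: "c \<in> ?D"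
    "\<And>x. x \<in> carrier G \<Longrightarrow> x \<otimes>\<^bsub>G\<^esub> c = c \<otimes>\<^bsub>G\<^esub> x" "G.ord c = p" by blast
  interpret D: normal ?D G by (rule D)
  have cG: "c \<in> carrier G" using c(1) D.subset by blast
  have pow_D: "c [^]\<^bsub>G\<^esub> i \<in> ?D" for i :: nat
    using G.subgroup_int_pow_closed[OF D.subgroup_axioms c(1), of "int i"] by (simp add: int_pow_int)
  obtain H :: "('a, 'b) monoid_scheme" and \<pi> where "cyclic_central_extension G H \<pi> c p"
    using G.ex_quotient_by_central[OF cG c(2)] p1 unfolding c(3) by auto
  then interpret E: cyclic_central_extension G H \<pi> c p .
  have derived_H: "derived H (carrier H) = \<pi> ` ?D"
    using E.derived_img[of "carrier G"] E.surj by simp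
  have finD: "finite ?D" using Suc.prems(2) D.subset by (rule finite_subset[rotated])
  have "card ?D = p * card (\<pi> ` ?D)"
    by (rule E.card_invariant_subset[OF D.subset finD]) (use pow_D in auto)
  then have cardD: "card (derived H (carrier H)) = p ^ Suc k"
    using Suc.prems(7) p1 by (simp add: derived_H)
  have "order G = p * order H"
    unfolding order_def using E.card_invariant_subset[OF _ Suc.prems(2)] cG E.surj by simp
  then have "order H dvd p ^ n" using Suc.prems(3) by (metis dvd_triv_right)
  then obtain n' where order_H: "order H = p ^ n'" using divides_primepow_nat[OF p] by blast
  have fin_H: "finite (carrier H)" using Suc.prems(2) by (simp flip: E.surj)
  obtain r where r: "\<And>z. z \<in> carrier H \<Longrightarrow> r z \<in> carrier G" "\<And>z. z \<in> carrier H \<Longrightarrow> \<pi> (r z) = z"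
    by (rule E.ex_representatives) blast
  interpret \<psi>: group_hom G A \<psi>
    by (intro group_hom.intro group_hom_axioms.intro G.is_group A.is_group Suc.prems(4))
  have "\<psi> c = \<one>\<^bsub>A\<^esub>" using Suc.prems(6)[OF cG] c(1) by simp
  then have \<psi>_c: "\<psi> (x \<otimes>\<^bsub>G\<^esub> c) = \<psi> x" if "x \<in> carrier G" for x
    using that cG by simp
  \<comment> \<open>Since \<open>c\<close> is in the kernel of \<open>\<psi>\<close>, the map
    factors through \<open>\<pi>\<close>; the factor is evaluated at representatives.\<close>
  have \<psi>_r: "\<psi> (r (\<pi> x)) = \<psi> x" if "x \<in> carrier G" for x
  proof (rule E.invariant_imp_constant_on_fibers[of \<psi>, OF \<psi>_c _ that])
    have "\<pi> x \<in> carrier H" using that by (rule E.hom_closed)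
    then show "r (\<pi> x) \<in> carrier G" "\<pi> (r (\<pi> x)) = \<pi> x" by (rule r)+
  qed
  have hom: "(\<lambda>z. \<psi> (r z)) \<in> hom H A"
  proof (rule homI)
    fix y z assume "y \<in> carrier H" "z \<in> carrier H"
    then obtain y' z' where yz: "y = \<pi> y'" "z = \<pi> z'" "y' \<in> carrier G" "z' \<in> carrier G"
      using E.ex_preimage by metis
    have "\<psi> (r (\<pi> (y' \<otimes>\<^bsub>G\<^esub> z'))) = \<psi> (r (\<pi> y')) \<otimes>\<^bsub>A\<^esub> \<psi> (r (\<pi> z'))"
      using yz(3,4) by (simp add: \<psi>_r del: E.hom_mult)
    then show "\<psi> (r (y \<otimes>\<^bsub>H\<^esub> z)) = \<psi> (r y) \<otimes>\<^bsub>A\<^esub> \<psi> (r z)"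
      using yz by simp
  qed (use r in auto)
  have surj: "(\<lambda>z. \<psi> (r z)) ` carrier H = carrier A"
  proof -
    have "(\<lambda>z. \<psi> (r z)) ` carrier H = (\<lambda>x. \<psi> (r (\<pi> x))) ` carrier G"
      by (simp add: image_image flip: E.surj)
    also have "\<dots> = carrier A" using \<psi>_r Suc.prems(5) by simp
    finally show ?thesis .
  qed
  have ker: "\<psi> (r z) = \<one>\<^bsub>A\<^esub> \<longleftrightarrow> z \<in> derived H (carrier H)" if "z \<in> carrier H" for z
  proof
    assume "\<psi> (r z) = \<one>\<^bsub>A\<^esub>"
    then have "r z \<in> ?D" using Suc.prems(6) r that by simp
    then show "z \<in> derived H (carrier H)" unfolding derived_H using r(2)[OF that] by (metis imageI)
  next
    assume "z \<in> derived H (carrier H)"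
    then obtain x where x: "x \<in> ?D" "z = \<pi> x" unfolding derived_H by blast
    then have "x \<in> carrier G" using D.subset by blast
    then show "\<psi> (r z) = \<one>\<^bsub>A\<^esub>" using x Suc.prems(6) \<psi>_r by simp
  qed
  have S: "\<pi> ` S \<subseteq> carrier H" "finite (\<pi> ` S)" "card (\<pi> ` S) \<le> d" "generate H (\<pi> ` S) = carrier H"
    using Suc.prems(8-11) card_image_le[OF Suc.prems(9), of \<pi>] E.generate_img[OF Suc.prems(8)] E.surj by auto
  have IH: "finite (carrier (schur_multiplier H))"
    "order (schur_multiplier H) \<le> order (schur_multiplier A) * p ^ ((d - 1) * k + 1)"
    using Suc.IH[OF E.H.is_group fin_H order_H hom surj ker cardD S] by auto
  have "S \<subseteq> generate G (insert c S)" "generate G S \<subseteq> generate G (insert c S)"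
    "generate G (insert c S) \<subseteq> carrier G"
    using G.mono_generate[of S "insert c S"] Suc.prems(8) cG G.generate_incl[of "insert c S"] 
    by (auto intro: generate.incl)
  then have gen: "generate G (insert c S) = carrier G" using Suc.prems(11) by auto
  note bound = E.schur_multiplier_bound[OF Suc.prems(8,9) E.symmetric_on_generators[OF _ Suc.prems(8) gen] IH(1)
      if_P[OF c(1), symmetric]]
  have "order (schur_multiplier G) * p \<le> order (schur_multiplier H) * p ^ card S"
    by (rule bound(2))
  also have "\<dots> \<le> (order (schur_multiplier A) * p ^ ((d - 1) * k + 1)) * p ^ d"
    using IH(2) Suc.prems(10) p1 by (intro mult_le_mono power_increasing) auto
  \<comment> \<open>One of the \<open>d\<close> factors \<open>p\<close> is set aside to cancel the
    transgression factor on the left.\<close>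
  also have "\<dots> = (order (schur_multiplier A) * p ^ ((d - 1) * Suc k + 1)) * p"
    using d by (cases d) (simp_all add: power_add mult_ac)
  finally have "order (schur_multiplier G) \<le> order (schur_multiplier A) * p ^ ((d - 1) * Suc k + 1)"
    using p1 by simp
  moreover have "finite (carrier (schur_multiplier G))" by (rule bound(1))
  ultimately show ?case by simp
qed

section \<open>The exponent\<close>

text \<open>Pairing the terms \<open>i\<close> and \<open>d + 1 - i\<close>.\<close>

lemma sum_index_mult_antimono_le:
  fixes a :: "nat \<Rightarrow> real"
  assumes d: "d \<ge> 1" and anti: "\<And>i j. 1 \<le> i \<Longrightarrow> i \<le> j \<Longrightarrow> j \<le> d \<Longrightarrow> a j \<le> a i"
  shows "2 * (\<Sum>i=1..d. a i * (real i - 1)) \<le> (real d - 1) * ((\<Sum>i=1..d. a i) - (a 1 - a d))"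
proof -
  \<comment> \<open>The weights 2i - d - 1 change sign under i \<mapsto> d + 1 - i, so symmetrising
    \<open>S\<close> produces differences of \<open>a\<close>.\<close>
  define t where "t i = (a i - a (d + 1 - i)) * (2 * real i - real d - 1)" for i
  define S where "S = (\<Sum>i=1..d. a i * (2 * real i - real d - 1))"
  have "S = (\<Sum>i=1..d. a (d + 1 - i) * (2 * real (d + 1 - i) - real d - 1))"
    unfolding S_def by (rule sum.atLeastAtMost_rev)
  also have "\<dots> = (\<Sum>i=1..d. - (a (d + 1 - i) * (2 * real i - real d - 1)))"
    by (intro sum.cong) (auto simp: of_nat_diff algebra_simps)
  finally have "2 * S = (\<Sum>i=1..d. t i)"
    by (simp add: S_def t_def left_diff_distrib sum_subtractf sum_negf)
  \<comment> \<open>Weight and difference have opposite signs, so every term is nonpositive; only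
    the outermost pair is kept.\<close>
  also have "\<dots> \<le> (\<Sum>i\<in>{1, d}. t i)"
  proof -
    have "t i \<le> 0" if i: "i \<in> {1..d}" for i
    proof (cases "2 * i \<ge> d + 1")
      case True
      then have "a i \<le> a (d + 1 - i)" "2 * real i - real d - 1 \<ge> 0" using i anti[of "d + 1 - i" i] by auto
      then show ?thesis by (simp add: t_def mult_nonpos_nonneg)
    next
      case False
      then have "a (d + 1 - i) \<le> a i" "2 * real i - real d - 1 \<le> 0" using i anti[of i "d + 1 - i"] by auto
      then show ?thesis by (simp add: t_def mult_nonneg_nonpos)
    qed
    then have "(\<Sum>i\<in>{1..d} - {1, d}. t i) \<le> 0" by (intro sum_nonpos) auto
    moreover have "(\<Sum>i=1..d. t i) = (\<Sum>i\<in>{1..d} - {1, d}. t i) + (\<Sum>i\<in>{1, d}. t i)"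
      using d by (intro sum.subset_diff) auto
    ultimately show ?thesis by simp
  qed
  also have "\<dots> = 2 * (- (real d - 1) * (a 1 - a d))"
    \<comment> \<open>For \<open>d = 1\<close> the two indices collapse to one and both sides
      vanish.\<close>
    using d by (cases "d = 1") (simp_all add: t_def algebra_simps)
  finally have "S \<le> - (real d - 1) * (a 1 - a d)" by linarith
  moreover have "S = 2 * (\<Sum>i=1..d. a i * (real i - 1)) - (real d - 1) * (\<Sum>i=1..d. a i)"
    by (simp add: S_def sum_distrib_left algebra_simps flip: sum_subtractf sum.distrib)
  ultimately show ?thesis by (simp add: algebra_simps)
qed

section \<open>Combination of the bounds\<close>

lemma product_group_cong:
  assumes "\<And>i. i \<in> I \<Longrightarrow> G i = H i"
  shows "product_group I G = product_group I H"
  using assms by (simp add: product_group_def cong: PiE_cong restrict_cong)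

theorem corollary1p3:
  fixes G :: "('a, 'b) monoid_scheme" and p n d k :: nat and \<alpha> :: "nat \<Rightarrow> nat"
  assumes "Factorial_Ring.prime p"
    and "group G" and "finite (carrier G)" and "\<not> comm_group G"
    and "order G = p ^ n"
    and "min_generators G = d"
    and "card (commutator_subgroup G) = p ^ k"
    and "abelianization G \<cong> product_group {1..d} (\<lambda>i. integer_mod_group (p ^ \<alpha> i))"
    and "\<And>i j. 1 \<le> i \<Longrightarrow> i \<le> j \<Longrightarrow> j \<le> d \<Longrightarrow> \<alpha> j \<le> \<alpha> i"
  shows "finite (carrier (schur_multiplier G)) \<and>
     real (order (schur_multiplier G)) \<le>
       real p powr (1 / 2 * (real d - 1) *
         (real n + real k - 2 - (real (\<alpha> 1) - real (\<alpha> d))) + 1) \<and>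
     (\<not> homocyclic (abelianization G) \<longrightarrow>
       real (order (schur_multiplier G)) \<le>
         real p powr (1 / 2 * (real d - 1) * (real n + real k - 3) + 1))"
proof -
  interpret G: group G by fact
  let ?D = "commutator_subgroup G"
  let ?A = "cyclic_product (\<lambda>i. p ^ \<alpha> i) d"
  have D: "?D \<lhd> G" using G.derived_is_normal[OF G.normal_self] .
  interpret D: normal ?D G by (rule D)
  have p1: "p > 1" using prime_gt_1_nat[OF assms(1)] .
  obtain h where h: "h \<in> iso (abelianization G) ?A" using assms(8) by (auto simp: is_iso_def)
  have A: "comm_group ?A"
    by (rule group.group_comm_groupI[OF group_cyclic_product]) (simp add: add.commute)
  define \<psi> where "\<psi> = h \<circ> (\<lambda>x. ?D #>\<^bsub>G\<^esub> x)"
  have \<psi>_hom: "\<psi> \<in> hom G ?A"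
    unfolding \<psi>_def using D.r_coset_hom_Mod h by (intro hom_compose) (auto simp: iso_def)
  have "\<psi> ` carrier G = h ` (\<lambda>x. ?D #>\<^bsub>G\<^esub> x) ` carrier G"
    by (simp only: \<psi>_def image_comp)
  also have "(\<lambda>x. ?D #>\<^bsub>G\<^esub> x) ` carrier G = carrier (abelianization G)"
    by (auto simp: FactGroup_def RCOSETS_def)
  also have "h ` \<dots> = carrier ?A"
    using h by (simp add: iso_def bij_betw_def)
  finally have \<psi>_surj: "\<psi> ` carrier G = carrier ?A" .
  interpret h: group_hom "abelianization G" ?A h
    by (intro group_hom.intro group_hom_axioms.intro D.factorgroup_is_group group_cyclic_product)
      (use h in \<open>simp add: iso_def\<close>)
  have \<psi>_ker: "\<psi> x = \<one>\<^bsub>?A\<^esub> \<longleftrightarrow> x \<in> ?D" if x: "x \<in> carrier G" for x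
  proof -
    have X: "?D #>\<^bsub>G\<^esub> x \<in> carrier (abelianization G)" using x by (auto simp: FactGroup_def RCOSETS_def)
    have inj: "inj_on h (carrier (abelianization G))" using h by (simp add: iso_def bij_betw_def)
    have "\<psi> x = \<one>\<^bsub>?A\<^esub> \<longleftrightarrow> h (?D #>\<^bsub>G\<^esub> x) = h \<one>\<^bsub>abelianization G\<^esub>"
      unfolding h.hom_one \<psi>_def comp_def ..
    also have "\<dots> \<longleftrightarrow> ?D #>\<^bsub>G\<^esub> x = \<one>\<^bsub>abelianization G\<^esub>"
      by (rule inj_on_eq_iff[OF inj X h.G.one_closed])
    also have "\<dots> \<longleftrightarrow> x \<in> ?D"
      using x D.rcos_const[OF G.is_group] G.coset_join1[OF _ x D.subgroup_axioms] by auto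
    finally show ?thesis .
  qed
  obtain S where S: "S \<subseteq> carrier G" "finite S" "card S = d" "generate G S = carrier G"
  proof -
    have "generate G (carrier G) = carrier G"
      using G.generate_incl[of "carrier G"] by (auto intro: generate.incl)
    then have "\<exists>r S. S \<subseteq> carrier G \<and> finite S \<and> card S = r \<and> generate G S = carrier G"
      using assms(3) by blast
    from LeastI_ex[OF this] show thesis
      using that assms(6) unfolding min_generators_def by blast
  qed
  have nontriv: "?D \<noteq> {\<one>\<^bsub>G\<^esub>}"
  proof
    assume triv: "?D = {\<one>\<^bsub>G\<^esub>}"
    have "x \<otimes>\<^bsub>G\<^esub> y = y \<otimes>\<^bsub>G\<^esub> x" if xy: "x \<in> carrier G" "y \<in> carrier G" for x y
    proof -
      have "x \<otimes>\<^bsub>G\<^esub> y \<otimes>\<^bsub>G\<^esub> inv\<^bsub>G\<^esub> x \<otimes>\<^bsub>G\<^esub> inv\<^bsub>G\<^esub> y \<in> ?D"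
        unfolding derived_def using xy by (intro generate.incl) blast
      then have "(x \<otimes>\<^bsub>G\<^esub> y) \<otimes>\<^bsub>G\<^esub> inv\<^bsub>G\<^esub> (y \<otimes>\<^bsub>G\<^esub> x) = \<one>\<^bsub>G\<^esub>"
        using triv xy by (simp add: G.inv_mult_group G.m_assoc)
      then show ?thesis using xy G.inv_solve_right'[of "\<one>\<^bsub>G\<^esub>" "x \<otimes>\<^bsub>G\<^esub> y" "y \<otimes>\<^bsub>G\<^esub> x"] by simp
    qed
    then have "comm_group G" by (rule G.group_comm_groupI)
    then show False using assms(4) by simp
  qed
  have "k \<noteq> 0"
  proof
    assume "k = 0"
    then have "card ?D = 1" using assms(7) by simp
    then obtain x where "?D = {x}" by (rule card_1_singletonE)
    then show False using nontriv D.one_closed by auto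
  qed
  \<comment> \<open>\<open>k'\<close> counts the reduction steps that precede the last one.\<close>
  then obtain k' where k: "k = Suc k'" by (cases k) auto
  have d: "d > 0"
  proof (rule ccontr)
    assume "\<not> d > 0"
    then have "carrier G = {\<one>\<^bsub>G\<^esub>}" using S G.generate_empty by auto
    then show False using nontriv D.subset D.one_closed by auto
  qed
  have q: "p ^ \<alpha> i > 0" for i using p1 by simp
  note M_A = schur_multiplier_cyclic_product[of "\<lambda>i. p ^ \<alpha> i", OF q, of d]
  have main: "finite (carrier (schur_multiplier G)) \<and>
    order (schur_multiplier G) \<le> order (schur_multiplier ?A) * p ^ ((d - 1) * k' + 1)"
    by (rule schur_multiplier_p_group_bound[OF assms(1) A M_A(1) assms(2,3,5) \<psi>_hom \<psi>_surj \<psi>_ker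
          assms(7)[unfolded k] S(1,2) _ S(4) d]) (use S in simp_all)
  have "p ^ n = p ^ (k + (\<Sum>i=1..d. \<alpha> i))"
  proof -
    have "order (abelianization G) * card ?D = p ^ n"
      using G.lagrange[OF D.subgroup_axioms] assms(5) by (simp add: order_def FactGroup_def)
    moreover have "order (abelianization G) = order ?A"
      using h by (auto simp: order_def iso_def intro: bij_betw_same_card)
    moreover have "order ?A = (\<Prod>i=1..d. p ^ \<alpha> i)"
      using p1 by (simp add: order_def card_PiE carrier_integer_mod_group nat_power_eq)
    ultimately show ?thesis by (simp add: assms(7) power_add power_sum mult.commute)
  qed
  then have n: "n = k + (\<Sum>i=1..d. \<alpha> i)" using p1 by simp
  define e where "e = (\<Sum>i=1..d. \<alpha> i * (i - 1)) + ((d - 1) * k' + 1)"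
  have "order (schur_multiplier G) \<le> p ^ e"
  proof -
    have "order (schur_multiplier G) \<le> (\<Prod>i=1..d. (p ^ \<alpha> i) ^ (i - 1)) * p ^ ((d - 1) * k' + 1)"
      using main mult_le_mono1[OF M_A(2)] by (meson le_trans)
    also have "\<dots> = p ^ e" unfolding e_def power_add power_sum by (simp add: power_mult)
    finally show ?thesis .
  qed
  then have "real (order (schur_multiplier G)) \<le> real (p ^ e)" by (rule of_nat_mono)
  also have "\<dots> = real p powr real e" using p1 by (simp add: powr_realpow)
  finally have M_le: "real (order (schur_multiplier G)) \<le> real p powr real e" .
  have e_le: "real e \<le> 1 / 2 * (real d - 1) * (real n + real k - 2 - (real (\<alpha> 1) - real (\<alpha> d))) + 1"
  proof -
    have "2 * (\<Sum>i=1..d. real (\<alpha> i) * (real i - 1)) \<le>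
        (real d - 1) * ((\<Sum>i=1..d. real (\<alpha> i)) - (real (\<alpha> 1) - real (\<alpha> d)))"
      using d assms(9) by (intro sum_index_mult_antimono_le) auto
    moreover have "(\<Sum>i=1..d. real (\<alpha> i) * (real i - 1)) = real (\<Sum>i=1..d. \<alpha> i * (i - 1))"
      by (simp add: of_nat_diff)
    moreover have "real e = real (\<Sum>i=1..d. \<alpha> i * (i - 1)) + ((real d - 1) * real k' + 1)"
      using d by (simp add: e_def of_nat_diff)
    \<comment> \<open>Substituting n = k + \<Sum> \<alpha> i turns n + k - 2 into 2k' + \<Sum>
      \<alpha> i, so half of it absorbs the cost of the \<open>k'\<close> steps.\<close>
    moreover have "real n + real k - 2 - (real (\<alpha> 1) - real (\<alpha> d)) =
        2 * real k' + ((\<Sum>i=1..d. real (\<alpha> i)) - (real (\<alpha> 1) - real (\<alpha> d)))"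
      by (simp add: n k)
    ultimately show ?thesis by (simp only: distrib_left)
  qed
  have mono: "real p powr real e \<le> real p powr x" if "real e \<le> x" for x
    using that p1 by (intro powr_mono) auto
  have "real (order (schur_multiplier G)) \<le>
      real p powr (1 / 2 * (real d - 1) * (real n + real k - 3) + 1)"
    if nh: "\<not> homocyclic (abelianization G)"
  proof -
    \<comment> \<open>By monotonicity, equal extremes would make all factors equal. As the exponents
      are integers, unequal extremes differ by at least 1, which turns the constant 2 into
      3.\<close>
    have "\<alpha> 1 \<noteq> \<alpha> d"
    proof
      assume eq: "\<alpha> 1 = \<alpha> d"
      have "integer_mod_group (p ^ \<alpha> i) = integer_mod_group (p ^ \<alpha> 1)" if "i \<in> {1..d}" for i
        using that assms(9)[of 1 i] assms(9)[of i d] eq by (intro arg_cong[where f = "\<lambda>a. integer_mod_group (p ^ a)"]) auto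
      then have "?A = product_group {1..d} (\<lambda>_. integer_mod_group (p ^ \<alpha> 1))"
        by (rule product_group_cong)
      then have "abelianization G \<cong> product_group {1..d} (\<lambda>_. integer_mod_group (p ^ \<alpha> 1))"
        using assms(8) by (rule subst)
      then have "homocyclic (abelianization G)"
        unfolding homocyclic_def using q[of 1] by blast
      then show False using nh by simp
    qed
    then have "real (\<alpha> 1) - real (\<alpha> d) \<ge> 1" using assms(9)[of 1 d] d by simp
    then have "1 / 2 * (real d - 1) * (real n + real k - 2 - (real (\<alpha> 1) - real (\<alpha> d))) \<le>
        1 / 2 * (real d - 1) * (real n + real k - 3)"
      using d by (intro mult_left_mono) auto
    then show ?thesis using M_le mono e_le by (meson add_right_mono order_trans)
  qed
  then show ?thesis using main M_le mono[OF e_le] by auto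
qed

end
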